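(* Let $n\ge2$ and let $G=\langle g_i : i\in I\rangle$ be a subgroup of the free group $F_n$ such that $\delta(G)=\delta(F_n)$. Then there exists a sequence of normal subgroups $N_k\triangleleft G$, $k\in\mathbb{N}$, such that $$\lim_{k\to\infty}\delta(N_k)=\frac12\,\delta(G).$$
   Context: $F_n$ is the free group of rank $n\ge2$ with a fixed free generating set $S$, and $d$ is the word metric with respect to $S$. For a subgroup $G<F_n$, the Poincaré exponent is $\delta(G):=\limsup_{R\to\infty}\frac1R\log \mathrm{card}\{g\in G\mid d(\mathrm{id},g)\le R\}$. One has $\delta(F_n)=\log(2n-1)$. *)

theory Defs
  imports "HOL-Algebra.Coset" "HOL-Algebra.Generated_Groups" "HOL-Library.Extended_Real" Complex_Main
begin

text \<open>A letter \<open>(s, b)\<close> stands for \<open>s\<close> if \<open>b\<close> holds and for the formal inverse of \<open>s\<close> otherwise.\<close>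

definition letter_value :: "('a, 'm) monoid_scheme \<Rightarrow> 'a \<times> bool \<Rightarrow> 'a" where
  "letter_value F l = (if snd l then fst l else inv\<^bsub>F\<^esub> (fst l))"

definition words :: "'a set \<Rightarrow> ('a \<times> bool) list set" where
  "words S = lists (S \<times> UNIV)"

definition word_value :: "('a, 'm) monoid_scheme \<Rightarrow> ('a \<times> bool) list \<Rightarrow> 'a" where
  "word_value F w = foldr (\<lambda>l x. letter_value F l \<otimes>\<^bsub>F\<^esub> x) w \<one>\<^bsub>F\<^esub>"

definition reduced :: "('a \<times> bool) list \<Rightarrow> bool" where
  "reduced w \<longleftrightarrow> successively (\<lambda>l l'. \<not> (fst l = fst l' \<and> snd l \<noteq> snd l')) w"

definition free_generating_set :: "('a, 'm) monoid_scheme \<Rightarrow> 'a set \<Rightarrow> bool" where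
  "free_generating_set F S \<longleftrightarrow>
     S \<subseteq> carrier F \<and>
     (\<forall>x\<in>carrier F. \<exists>!w. w \<in> words S \<and> reduced w \<and> word_value F w = x)"

text \<open>The \<open>LEAST\<close> is only meaningful when \<open>S\<close> generates \<open>F\<close>.\<close>

definition word_length :: "('a, 'm) monoid_scheme \<Rightarrow> 'a set \<Rightarrow> 'a \<Rightarrow> nat" where
  "word_length F S x = (LEAST k. \<exists>w\<in>words S. word_value F w = x \<and> length w = k)"

definition word_metric :: "('a, 'm) monoid_scheme \<Rightarrow> 'a set \<Rightarrow> 'a \<Rightarrow> 'a \<Rightarrow> nat" where
  "word_metric F S x y = word_length F S (inv\<^bsub>F\<^esub> x \<otimes>\<^bsub>F\<^esub> y)"

text \<open>The value is an extended real, so that the limit superior needs no boundedness proviso.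
  The balls below are finite whenever \<open>S\<close> is a finite generating set.\<close>

definition poincare_exponent :: "('a, 'm) monoid_scheme \<Rightarrow> 'a set \<Rightarrow> 'a set \<Rightarrow> ereal" where
  "poincare_exponent F S G =
     Limsup at_top (\<lambda>R::real.
       ereal (1 / R * ln (real (card {g \<in> G. real (word_metric F S \<one>\<^bsub>F\<^esub> g) \<le> R}))))"

end

theory Submission
  imports Defs
begin

text \<open>
  Write \<open>n\<close> for the rank and \<open>q = 2n - 1\<close> for the growth rate of the tree on which \<open>F\<close> acts.
  The subgroups are \<open>N k = G \<inter> M k\<close>, where \<open>M k\<close> is a normal subgroup of \<open>F\<close> (hence \<open>N k\<close> is
  normal in \<open>G\<close>) whose own exponent is only slightly larger than \<open>ln q / 2\<close>. Three
  facts make this work.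

  \<^item> A nontrivial normal subgroup \<open>N\<close> of \<open>G\<close> has exponent at least half that of \<open>G\<close>
    (\<open>half_poincare_exponent_le_normal\<close>): it contains all conjugates \<open>g h g\<inverse>\<close> of some
    \<open>h \<noteq> 1\<close>, these have length at most \<open>2 |g| + |h|\<close>, and two elements \<open>g\<close> give the same conjugate
    only if they differ by an element of the centralizer of \<open>h\<close>, which has linear growth.

  \<^item> For large \<open>m\<close> the kernel \<open>M\<close> of the action of \<open>F\<close> on the normal forms of the free product of
    \<open>n\<close> cyclic groups of order \<open>m\<close> has exponent close to \<open>ln q / 2\<close>
    (\<open>poincare_exponent_action_kernel_bound\<close>). The orbit graph is a cactus, a tree of
    \<open>m\<close>-cycles, and elements of \<open>M\<close> trace closed non-backtracking walks in it. On a tree,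
    such walks are controlled by a weight decaying like \<open>q powr (- d / 2)\<close> with the
    distance \<open>d\<close> from the root; on a cactus with long cycles a small perturbation of that weight
    still works.

  \<^item> The intersection \<open>G \<inter> M\<close> is nontrivial
    (\<open>poincare_exponent_less_of_trivial_intersection\<close>): otherwise \<open>G\<close> would embed into
    \<open>F / M\<close>. Shortest coset representatives do not contain the \<open>m\<close>-th power of a
    letter, so \<open>F / M\<close> grows strictly more slowly than \<open>F\<close>, whereas \<open>G\<close> has full exponent.
    This is where the hypothesis on \<open>G\<close> enters, besides identifying the limit.

  Since \<open>\<delta>(F) \<ge> ln q\<close>, these bounds squeeze the exponents of \<open>N k\<close> to \<open>\<delta>(G) / 2\<close>.
\<close>

section \<open>Reduced words and free bases\<close>

definition inv_letter :: "'a \<times> bool \<Rightarrow> 'a \<times> bool" where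
  "inv_letter l = (fst l, \<not> snd l)"

lemma inv_letter_inv_letter [simp]: "inv_letter (inv_letter l) = l"
  by (simp add: inv_letter_def)

lemma inv_letter_neq [simp]: "inv_letter l \<noteq> l" "l \<noteq> inv_letter l"
  by (auto simp: inv_letter_def prod_eq_iff)

lemma inv_letter_eq_swap: "inv_letter l = l' \<longleftrightarrow> l = inv_letter l'"
  by (metis inv_letter_inv_letter)

lemma inv_letter_mem_iff [simp]: "inv_letter l \<in> S \<times> UNIV \<longleftrightarrow> l \<in> S \<times> UNIV"
  by (cases l) (auto simp: inv_letter_def)

definition inv_word :: "('a \<times> bool) list \<Rightarrow> ('a \<times> bool) list" where
  "inv_word w = rev (map inv_letter w)"

text \<open>Left multiplication by a letter, expressed on reduced words.\<close>

definition cons_reduce :: "'a \<times> bool \<Rightarrow> ('a \<times> bool) list \<Rightarrow> ('a \<times> bool) list" where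
  "cons_reduce l w = (if w \<noteq> [] \<and> hd w = inv_letter l then tl w else l # w)"

lemma reduced_Nil [simp]: "reduced []"
  by (simp add: reduced_def)

lemma reduced_Cons: "reduced (l # w) \<longleftrightarrow> reduced w \<and> (w = [] \<or> hd w \<noteq> inv_letter l)"
  by (cases w) (auto simp: reduced_def inv_letter_def prod_eq_iff)

lemma reduced_append:
  "reduced (u @ v) \<longleftrightarrow> reduced u \<and> reduced v \<and> (u = [] \<or> v = [] \<or> hd v \<noteq> inv_letter (last u))"
  by (induction u) (auto simp: reduced_Cons)

lemma reduced_inv_word: "reduced w \<Longrightarrow> reduced (inv_word w)"
proof (induction w)
  case (Cons l w)
  then show ?case
    by (cases w) (auto simp: reduced_Cons reduced_append inv_word_def inv_letter_eq_swap)
qed (simp add: inv_word_def)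

lemma length_inv_word [simp]: "length (inv_word w) = length w"
  by (simp add: inv_word_def)

lemma last_inv_word: "w \<noteq> [] \<Longrightarrow> last (inv_word w) = inv_letter (hd w)"
  by (cases w) (auto simp: inv_word_def)

lemma hd_inv_word: "w \<noteq> [] \<Longrightarrow> hd (inv_word w) = inv_letter (last w)"
  by (cases w rule: rev_cases) (auto simp: inv_word_def)

lemma words_Nil [simp]: "[] \<in> words S"
  by (simp add: words_def)

lemma words_Cons [simp]: "l # w \<in> words S \<longleftrightarrow> l \<in> S \<times> UNIV \<and> w \<in> words S"
  by (simp add: words_def)

lemma words_append [simp]: "u @ v \<in> words S \<longleftrightarrow> u \<in> words S \<and> v \<in> words S"
  by (simp add: words_def)

lemma inv_word_in_words [simp]: "inv_word w \<in> words S \<longleftrightarrow> w \<in> words S"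
  by (induction w) (auto simp: inv_word_def)

lemma reduced_cons_reduce: "reduced w \<Longrightarrow> reduced (cons_reduce l w)"
  by (cases w) (auto simp: cons_reduce_def reduced_Cons)

lemma cons_reduce_in_words: "l \<in> S \<times> UNIV \<Longrightarrow> w \<in> words S \<Longrightarrow> cons_reduce l w \<in> words S"
  by (cases w) (auto simp: cons_reduce_def)

lemma length_cons_reduce_le: "length (cons_reduce l w) \<le> Suc (length w)"
  by (auto simp: cons_reduce_def)

locale free_basis = group F for F (structure) +
  fixes S
  assumes basis: "free_generating_set F S"
begin

abbreviation letters where "letters \<equiv> S \<times> (UNIV :: bool set)"

abbreviation val where "val \<equiv> word_value F"

definition nf where
  "nf x = (THE w. w \<in> words S \<and> reduced w \<and> val w = x)"

lemma gens_closed: "s \<in> S \<Longrightarrow> s \<in> carrier F"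
  using basis by (auto simp: free_generating_set_def)

lemma letter_value_closed [simp]: "l \<in> letters \<Longrightarrow> letter_value F l \<in> carrier F"
  using gens_closed by (auto simp: letter_value_def)

lemma letter_value_inv: "l \<in> letters \<Longrightarrow> letter_value F (inv_letter l) = inv (letter_value F l)"
  using gens_closed by (auto simp: letter_value_def inv_letter_def)

lemma val_Nil [simp]: "val [] = \<one>"
  by (simp add: word_value_def)

lemma val_Cons [simp]: "val (l # w) = letter_value F l \<otimes> val w"
  by (simp add: word_value_def)

lemma val_closed [simp]: "w \<in> words S \<Longrightarrow> val w \<in> carrier F"
  by (induction w) auto

lemma val_append: "u \<in> words S \<Longrightarrow> v \<in> words S \<Longrightarrow> val (u @ v) = val u \<otimes> val v"
  by (induction u) (auto simp: m_assoc simp del: mem_Times_iff)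

lemma val_inv_word: "w \<in> words S \<Longrightarrow> val (inv_word w) = inv (val w)"
proof (induction w)
  case (Cons l w)
  have eq: "inv_word (l # w) = inv_word w @ [inv_letter l]"
    by (simp add: inv_word_def)
  show ?case
    using Cons unfolding eq
    by (subst val_append) (simp_all add: letter_value_inv inv_mult_group del: mem_Times_iff)
qed (simp add: inv_word_def)

lemma val_cons_reduce:
  assumes "l \<in> letters" "w \<in> words S"
  shows "val (cons_reduce l w) = letter_value F l \<otimes> val w"
proof (cases w)
  case (Cons l' w')
  with assms show ?thesis
    by (auto simp: cons_reduce_def letter_value_inv m_assoc[symmetric] simp del: mem_Times_iff)
qed (simp add: cons_reduce_def)

lemma nf_props:
  assumes "x \<in> carrier F"
  shows "nf x \<in> words S" "reduced (nf x)" "val (nf x) = x"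
proof -
  have "\<exists>!w. w \<in> words S \<and> reduced w \<and> val w = x"
    using basis assms by (auto simp: free_generating_set_def)
  from theI'[OF this] show "nf x \<in> words S" "reduced (nf x)" "val (nf x) = x"
    by (simp_all add: nf_def)
qed

lemma nf_val [simp]:
  assumes "w \<in> words S" "reduced w"
  shows "nf (val w) = w"
proof -
  have "\<exists>!v. v \<in> words S \<and> reduced v \<and> val v = val w"
    using basis assms by (auto simp: free_generating_set_def)
  with nf_props[of "val w"] assms show ?thesis by auto
qed

lemma inj_on_nf: "inj_on nf (carrier F)"
  by (metis inj_onI nf_props(3))

lemma nf_one [simp]: "nf \<one> = []"
  using nf_val[of "[]"] by simp

lemma nf_eq_Nil_iff: "x \<in> carrier F \<Longrightarrow> nf x = [] \<longleftrightarrow> x = \<one>"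
  using nf_props(3)[of x] by auto

lemma nf_letter_mult:
  assumes "l \<in> letters" "x \<in> carrier F"
  shows "nf (letter_value F l \<otimes> x) = cons_reduce l (nf x)"
  using assms nf_props[OF assms(2)]
  by (metis cons_reduce_in_words nf_val reduced_cons_reduce val_cons_reduce)

lemma nf_inv: "x \<in> carrier F \<Longrightarrow> nf (inv x) = inv_word (nf x)"
  by (metis inv_word_in_words nf_props nf_val reduced_inv_word val_inv_word)

lemma length_nf_val_le: "w \<in> words S \<Longrightarrow> length (nf (val w)) \<le> length w"
proof (induction w)
  case (Cons l w)
  then show ?case
    using length_cons_reduce_le[of l "nf (val w)"] by (auto simp: nf_letter_mult simp del: mem_Times_iff)
qed simp

lemma word_length_eq:
  assumes "x \<in> carrier F"
  shows "word_length F S x = length (nf x)"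
  unfolding word_length_def
  by (rule Least_equality) (use nf_props[OF assms] length_nf_val_le in auto)

lemma word_metric_one_eq: "x \<in> carrier F \<Longrightarrow> word_metric F S \<one> x = length (nf x)"
  by (simp add: word_metric_def word_length_eq)

lemma length_nf_mult_le:
  assumes "x \<in> carrier F" "y \<in> carrier F"
  shows "length (nf (x \<otimes> y)) \<le> length (nf x) + length (nf y)"
  using length_nf_val_le[of "nf x @ nf y"] nf_props[OF assms(1)] nf_props[OF assms(2)]
  by (simp add: val_append)

lemma length_nf_inv: "x \<in> carrier F \<Longrightarrow> length (nf (inv x)) = length (nf x)"
  by (simp add: nf_inv)

text \<open>Products behave like concatenation exactly when nothing cancels at the seam.\<close>

lemma nf_mult_no_cancel:
  assumes "x \<in> carrier F" "y \<in> carrier F" "reduced (nf x @ nf y)"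
  shows "nf (x \<otimes> y) = nf x @ nf y"
  using nf_val[of "nf x @ nf y"] assms nf_props[OF assms(1)] nf_props[OF assms(2)]
  by (simp add: val_append)

text \<open>A cancellation at the seam would leave a word for the product that is two letters shorter, so the
  length alone detects that the normal forms concatenate.\<close>

lemma nf_mult_of_length:
  assumes x: "x \<in> carrier F" and y: "y \<in> carrier F"
    and len: "length (nf (x \<otimes> y)) = length (nf x) + length (nf y)"
  shows "nf (x \<otimes> y) = nf x @ nf y"
proof (rule nf_mult_no_cancel[OF x y], rule ccontr)
  assume "\<not> reduced (nf x @ nf y)"
  then have ne: "nf x \<noteq> []" "nf y \<noteq> []" and h: "hd (nf y) = inv_letter (last (nf x))"
    using nf_props[OF x] nf_props[OF y] by (auto simp: reduced_append)
  obtain u l where u: "nf x = u @ [l]" using ne(1) by (cases "nf x" rule: rev_cases) auto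
  obtain v where v: "nf y = inv_letter l # v" using ne(2) h u by (cases "nf y") auto
  have w: "u \<in> words S" "v \<in> words S" "l \<in> letters"
    using nf_props[OF x] nf_props[OF y] u v by auto
  have "x \<otimes> y = val (nf x @ nf y)"
    using nf_props[OF x] nf_props[OF y] by (simp add: val_append)
  also have "\<dots> = val u \<otimes> (letter_value F l \<otimes> (inv (letter_value F l) \<otimes> val v))"
    using w by (simp add: u v val_append letter_value_inv del: mem_Times_iff)
  also have "\<dots> = val (u @ v)"
    using w by (simp add: val_append m_assoc[symmetric] del: mem_Times_iff)
  finally have "length (nf (x \<otimes> y)) \<le> length (u @ v)"
    using length_nf_val_le[of "u @ v"] w by simp
  then show False using len u v by simp
qed

end

section \<open>Counting reduced words with weights\<close>

lemma ln_le_iff_le_exp: "0 < x \<Longrightarrow> ln x \<le> y \<longleftrightarrow> x \<le> exp (y :: real)"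
  by (metis exp_le_cancel_iff exp_ln)

locale finite_free_basis = free_basis +
  assumes finite_gens: "finite S"
begin

definition ball where
  "ball H r = {g \<in> H. length (nf g) \<le> r}"

text \<open>Words grow at the front, because the head of a word is the letter that acts last. A reduced
  word is thus a non-backtracking walk read from right to left.\<close>

definition next_letters where
  "next_letters w = {l \<in> letters. reduced (l # w)}"

definition sphere_words where
  "sphere_words r = {w \<in> words S. reduced w \<and> length w = r}"

lemma finite_letters: "finite letters"
  using finite_gens by simp

lemma finite_next_letters [simp]: "finite (next_letters w)"
  using finite_letters by (simp add: next_letters_def)

lemma finite_words_le: "finite {w \<in> words S. length w \<le> r}"
  using finite_lists_length_le[OF finite_letters, of r]
  by (simp add: words_def lists_eq_set conj_commute)

lemma finite_sphere_words [simp]: "finite (sphere_words r)"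
  by (rule finite_subset[OF _ finite_words_le[of r]]) (auto simp: sphere_words_def)

lemma next_letters_eq:
  assumes "reduced w" "w \<noteq> []"
  shows "next_letters w = letters - {inv_letter (hd w)}"
  using assms by (auto simp: next_letters_def reduced_Cons inv_letter_eq_swap)

lemma card_next_letters:
  assumes "w \<in> words S" "reduced w" "w \<noteq> []"
  shows "card (next_letters w) = 2 * card S - 1"
proof -
  have "inv_letter (hd w) \<in> letters"
    using assms by (cases w) auto
  then show ?thesis
    using assms finite_letters by (simp add: next_letters_eq card_cartesian_product del: mem_Times_iff)
qed

lemma sum_sphere_words_Suc:
  "(\<Sum>w\<in>sphere_words (Suc r). \<Phi> w) = (\<Sum>w\<in>sphere_words r. \<Sum>l\<in>next_letters w. \<Phi> (l # w))"
proof -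
  have "(\<Sum>w\<in>sphere_words r. \<Sum>l\<in>next_letters w. \<Phi> (l # w)) =
        (\<Sum>(w, l)\<in>Sigma (sphere_words r) next_letters. \<Phi> (l # w))"
    by (rule sum.Sigma) auto
  also have "\<dots> = (\<Sum>w\<in>sphere_words (Suc r). \<Phi> w)"
    by (rule sum.reindex_bij_witness[where i = "\<lambda>w. (tl w, hd w)" and j = "\<lambda>(w, l). l # w"])
      (auto simp: sphere_words_def next_letters_def length_Suc_conv reduced_Cons)
  finally show ?thesis ..
qed

lemma card_sphere_words_ge: 
  assumes "S \<noteq> {}"
  shows "(2 * card S - 1) ^ r \<le> card (sphere_words (Suc r))"
proof (induction r)
  case 0
  obtain s where "s \<in> S" using assms by auto
  then have "[(s, True)] \<in> sphere_words 1"
    by (simp add: sphere_words_def reduced_Cons)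
  then show ?case
    using card_0_eq[OF finite_sphere_words, of 1] by (auto simp del: card_0_eq)
next
  case (Suc r)
  have "card (sphere_words (Suc (Suc r))) = (\<Sum>w\<in>sphere_words (Suc (Suc r)). 1)"
    by simp
  also have "\<dots> = (\<Sum>w\<in>sphere_words (Suc r). card (next_letters w))"
    unfolding sum_sphere_words_Suc by simp
  also have "\<dots> = (\<Sum>w\<in>sphere_words (Suc r). 2 * card S - 1)"
    by (intro sum.cong refl card_next_letters) (auto simp: sphere_words_def)
  finally have "card (sphere_words (Suc (Suc r))) = card (sphere_words (Suc r)) * (2 * card S - 1)"
    by simp
  with mult_le_mono1[OF Suc, of "2 * card S - 1"] show ?case
    by (simp add: mult.commute)
qed

text \<open>A weight that does not grow by more than a factor \<open>lam\<close> under the transfer operator of the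
  non-backtracking walk bounds the number of walks; both upper bounds on growth below, for the kernel and for
  the coset representatives, come from this estimate.\<close>

lemma transfer_sum_le:
  fixes \<Phi> :: "('a \<times> bool) list \<Rightarrow> real"
  assumes step: "\<And>w. w \<in> words S \<Longrightarrow> reduced w \<Longrightarrow> w \<noteq> [] \<Longrightarrow> (\<Sum>l\<in>next_letters w. \<Phi> (l # w)) \<le> lam * \<Phi> w"
    and "lam \<ge> 0"
  shows "(\<Sum>w\<in>sphere_words (Suc r). \<Phi> w) \<le> lam ^ r * (\<Sum>w\<in>sphere_words 1. \<Phi> w)"
proof (induction r)
  case (Suc r)
  have "(\<Sum>w\<in>sphere_words (Suc (Suc r)). \<Phi> w) \<le> (\<Sum>w\<in>sphere_words (Suc r). lam * \<Phi> w)"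
    unfolding sum_sphere_words_Suc[of _ "Suc r"] by (intro sum_mono step) (auto simp: sphere_words_def)
  also have "\<dots> = lam * (\<Sum>w\<in>sphere_words (Suc r). \<Phi> w)"
    by (simp add: sum_distrib_left)
  also have "\<dots> \<le> lam * (lam ^ r * (\<Sum>w\<in>sphere_words 1. \<Phi> w))"
    using Suc \<open>lam \<ge> 0\<close> by (rule mult_left_mono)
  finally show ?case by (simp add: mult.assoc)
qed simp

text \<open>The weight is bounded below on \<open>W\<close> but may decay elsewhere. This is how a rate below the
  growth \<open>q\<close> of all reduced words can arise.\<close>

lemma card_words_le_of_weight:
  fixes \<Phi> :: "('a \<times> bool) list \<Rightarrow> real"
  assumes step: "\<And>w. w \<in> words S \<Longrightarrow> reduced w \<Longrightarrow> w \<noteq> [] \<Longrightarrow> (\<Sum>l\<in>next_letters w. \<Phi> (l # w)) \<le> lam * \<Phi> w"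
    and nonneg: "\<And>w. w \<in> words S \<Longrightarrow> reduced w \<Longrightarrow> \<Phi> w \<ge> 0"
    and W: "W \<subseteq> {w \<in> words S. reduced w}"
    and m: "m > 0" "\<And>w. w \<in> W \<Longrightarrow> w \<noteq> [] \<Longrightarrow> m \<le> \<Phi> w"
    and lam: "lam > 1"
  shows "\<exists>C>0. \<forall>r. real (card {w \<in> W. length w \<le> r}) \<le> C * lam ^ r"
proof -
  define A where "A = (\<Sum>w\<in>sphere_words 1. \<Phi> w)"
  define D where "D = A / (m * (lam - 1))"
  define C where "C = 1 + D"
  have A: "A \<ge> 0"
    unfolding A_def by (intro sum_nonneg nonneg) (auto simp: sphere_words_def)
  have C: "C \<ge> 1"
    using A m lam by (simp add: C_def D_def)
  have fin: "finite {w \<in> W. length w \<le> r}" for r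
    by (rule finite_subset[OF _ finite_words_le[of r]]) (use W in auto)
  have sphere: "real (card (W \<inter> sphere_words (Suc r))) \<le> A / m * lam ^ r" for r
  proof -
    have "m * card (W \<inter> sphere_words (Suc r)) = (\<Sum>w\<in>W \<inter> sphere_words (Suc r). m)"
      by simp
    also have "\<dots> \<le> (\<Sum>w\<in>W \<inter> sphere_words (Suc r). \<Phi> w)"
      by (intro sum_mono m(2)) (auto simp: sphere_words_def)
    also have "\<dots> \<le> (\<Sum>w\<in>sphere_words (Suc r). \<Phi> w)"
      by (intro sum_mono2[OF finite_sphere_words] nonneg) (auto simp: sphere_words_def)
    also have "\<dots> \<le> lam ^ r * A"
      unfolding A_def by (intro transfer_sum_le step) (use lam in auto)
    finally show ?thesis using m(1) by (simp add: field_simps)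
  qed
  have "real (card {w \<in> W. length w \<le> r}) \<le> 1 + D * (lam ^ r - 1)" for r
  proof (induction r)
    case 0
    have "{w \<in> W. length w \<le> 0} \<subseteq> {[]}" by auto
    from card_mono[OF _ this] show ?case by simp
  next
    case (Suc r)
    have eq: "{w \<in> W. length w \<le> Suc r} = {w \<in> W. length w \<le> r} \<union> (W \<inter> sphere_words (Suc r))"
      using W by (auto simp: sphere_words_def)
    have "real (card {w \<in> W. length w \<le> Suc r})
        \<le> real (card {w \<in> W. length w \<le> r}) + real (card (W \<inter> sphere_words (Suc r)))"
      unfolding eq of_nat_add[symmetric] of_nat_le_iff by (rule card_Un_le)
    also have "\<dots> \<le> 1 + D * (lam ^ r - 1) + A / m * lam ^ r"
      using Suc sphere[of r] by linarith
    also have "A / m * lam ^ r = D * (lam ^ r * (lam - 1))"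
      using lam m by (simp add: D_def field_simps)
    also have "1 + D * (lam ^ r - 1) + D * (lam ^ r * (lam - 1)) = 
       1 + D * (lam ^ Suc r - 1)"
      by (simp add: algebra_simps)
    finally show ?case .
  qed
  moreover have "1 + D * (lam ^ r - 1) \<le> C * lam ^ r" for r
  proof -
    have "1 \<le> lam ^ r" using lam by simp
    moreover have "D \<ge> 0" using A m lam by (simp add: D_def)
    ultimately show ?thesis unfolding C_def by (simp add: algebra_simps)
  qed
  ultimately show ?thesis
    using C by (intro exI[of _ C]) (auto intro: order_trans)
qed

lemma finite_ball: "H \<subseteq> carrier F \<Longrightarrow> finite (ball H r)"
proof (rule inj_on_finite[OF _ _ finite_words_le[of r]])
  show "inj_on nf (ball H r)" if "H \<subseteq> carrier F"
    by (rule inj_on_subset[OF inj_on_nf]) (use that in \<open>auto simp: ball_def\<close>)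
qed (auto simp: ball_def nf_props subset_iff)

lemma ball_subset_metric:
  assumes "H \<subseteq> carrier F" "R \<ge> 0"
  shows "{g \<in> H. real (word_metric F S \<one> g) \<le> R} = ball H (nat \<lfloor>R\<rfloor>)"
  unfolding ball_def using assms
  by (intro Collect_cong conj_cong refl) (auto simp: word_metric_one_eq subset_iff le_nat_floor nat_le_iff le_floor_iff le_nat_iff)

lemma poincare_exponent_le:
  assumes H: "H \<subseteq> carrier F" and c: "c \<ge> 0" and C: "C > 0"
    and bound: "\<And>r. r \<ge> r0 \<Longrightarrow> real (card (ball H r)) \<le> C * exp (c * real r)"
  shows "poincare_exponent F S H \<le> ereal c"
proof -
  let ?f = "\<lambda>R::real. ereal (1 / R * ln (real (card {g \<in> H. real (word_metric F S \<one> g) \<le> R})))"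
  let ?C = "max C 1"
  let ?g = "\<lambda>R::real. ereal (1 / R * ln ?C + c)"
  have "Limsup at_top ?f \<le> Limsup at_top ?g"
  proof (rule Limsup_mono, rule eventually_mono[OF eventually_ge_at_top[of "real (r0 + 1)"]])
    fix R :: real assume R: "R \<ge> real (r0 + 1)"
    then have R0: "R > 0" by simp
    let ?N = "real (card (ball H (nat \<lfloor>R\<rfloor>)))"
    have "nat \<lfloor>R\<rfloor> \<ge> r0" using R by (simp add: le_nat_floor)
    from bound[OF this] have "?N \<le> C * exp (c * real (nat \<lfloor>R\<rfloor>))" .
    also have "\<dots> \<le> ?C * exp (c * R)"
      using C c R0 by (intro mult_mono) (auto intro!: mult_left_mono of_nat_floor)
    finally have N: "?N \<le> ?C * exp (c * R)" .
    have "ln ?N \<le> ln (?C * exp (c * R))"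
    proof (cases "?N = 0")
      case True
      have "1 * 1 \<le> ?C * exp (c * R)" using c R0 by (intro mult_mono) auto
      with True show ?thesis by simp
    next
      case False
      with N show ?thesis by (subst ln_le_cancel_iff) auto
    qed
    also have "\<dots> = ln ?C + c * R" by (subst ln_mult) auto
    finally have "1 / R * ln ?N \<le> 1 / R * ln ?C + c"
      using R0 by (simp add: field_simps)
    then show "?f R \<le> ?g R"
      using R0 by (simp add: ball_subset_metric[OF H])
  qed
  also have "Limsup at_top ?g = ereal c"
  proof (rule lim_imp_Limsup)
    have "((\<lambda>R::real. 1 / R * ln ?C + c) \<longlongrightarrow> 0 * ln ?C + c) at_top"
      by (intro tendsto_intros tendsto_divide_0[OF tendsto_const] filterlim_at_top_imp_at_infinity filterlim_ident)
    then show "(?g \<longlongrightarrow> ereal c) at_top" by simp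
  qed simp
  finally show ?thesis by (simp add: poincare_exponent_def)
qed

text \<open>Together with \<open>poincare_exponent_le\<close> this trades the limit superior over real radii for
  exponential bounds at integer radii.\<close>

lemma card_ball_le_of_poincare_exponent_less:
  assumes H: "H \<subseteq> carrier F" and less: "poincare_exponent F S H < ereal c"
  obtains r0 where "\<And>r. r \<ge> r0 \<Longrightarrow> real (card (ball H r)) \<le> exp (c * real r)"
proof -
  let ?f = "\<lambda>R::real. ereal (1 / R * ln (real (card {g \<in> H. real (word_metric F S \<one> g) \<le> R})))"
  have "eventually (\<lambda>R. ?f R < ereal c) at_top"
    using less unfolding poincare_exponent_def by (rule Limsup_lessD)
  then obtain R0 where R0: "\<And>R. R \<ge> R0 \<Longrightarrow> ?f R < ereal c"
    by (auto simp: eventually_at_top_linorder)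
  show ?thesis
  proof (rule that)
    fix r :: nat assume r: "r \<ge> nat \<lceil>R0\<rceil> + 1"
    then have "real r \<ge> R0" "r > 0" by linarith+
    have "{g \<in> H. real (word_metric F S \<one> g) \<le> real r} = ball H r"
      using ball_subset_metric[OF H, of "real r"] by simp
    with R0[OF \<open>real r \<ge> R0\<close>] have "1 / real r * ln (real (card (ball H r))) < c"
      by simp
    then have "ln (real (card (ball H r))) \<le> c * real r"
      using \<open>r > 0\<close> by (simp add: field_simps)
    then show "real (card (ball H r)) \<le> exp (c * real r)"
      by (cases "card (ball H r) = 0") (simp_all add: ln_le_iff_le_exp less_imp_le flip: of_nat_0_less_iff)
  qed
qed

lemma poincare_exponent_carrier_ge:
  assumes "card S \<ge> 2"
  shows "ereal (ln (real (2 * card S - 1))) \<le> poincare_exponent F S (carrier F)"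
proof (rule ccontr)
  let ?q = "real (2 * card S - 1)"
  assume "\<not> ?thesis"
  then obtain c where c: "poincare_exponent F S (carrier F) < ereal c" "ereal c < ereal (ln ?q)"
    using ereal_dense2 by (metis not_le_imp_less)
  obtain r0 where r0: "\<And>r. r \<ge> r0 \<Longrightarrow> real (card (ball (carrier F) r)) \<le> exp (c * real r)"
    using card_ball_le_of_poincare_exponent_less[OF subset_refl c(1)] by blast
  have q: "?q > 0" using assms by simp
  define d where "d = ln ?q - c"
  have d: "d > 0" using c by (simp add: d_def)
  have *: "real r * d \<le> c" if "r \<ge> r0" for r
  proof -
    have "w \<in> nf ` ball (carrier F) (Suc r)" if "w \<in> sphere_words (Suc r)" for w
      by (rule image_eqI[of _ _ "val w"]) (use that in \<open>auto simp: sphere_words_def ball_def\<close>)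
    then have "sphere_words (Suc r) \<subseteq> nf ` ball (carrier F) (Suc r)" by blast
    then have "card (sphere_words (Suc r)) \<le> card (ball (carrier F) (Suc r))"
      by (meson card_image_le card_mono finite_ball finite_imageI order_trans subset_refl)
    then have "(2 * card S - 1) ^ r \<le> card (ball (carrier F) (Suc r))"
      using card_sphere_words_ge[of r] assms by fastforce
    then have "?q ^ r \<le> real (card (ball (carrier F) (Suc r)))"
      by (metis of_nat_le_iff of_nat_power)
    also have "\<dots> \<le> exp (c * real (Suc r))" using r0[of "Suc r"] that by simp
    finally have "ln (?q ^ r) \<le> c * real (Suc r)" using q by (subst ln_le_iff_le_exp) auto
    then show ?thesis using q by (simp add: d_def ln_realpow algebra_simps)
  qed
  obtain r :: nat where r: "real r > max (real r0) (c / d)" using reals_Archimedean2 by blast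
  then have "c < real r * d" using d by (simp add: field_simps)
  with *[of r] r show False by simp
qed

end

section \<open>Normal subgroups have at least half the exponent\<close>

definition cyclically_reduced :: "('a \<times> bool) list \<Rightarrow> bool" where
  "cyclically_reduced w \<longleftrightarrow> w \<noteq> [] \<and> hd w \<noteq> inv_letter (last w)"

lemma cyclically_reduced_inv_word: "cyclically_reduced w \<Longrightarrow> cyclically_reduced (inv_word w)"
  by (auto simp: cyclically_reduced_def hd_inv_word last_inv_word) (auto simp: inv_word_def)

lemma card_le_card_image_times_fibre:
  assumes "finite A" and fibre: "\<And>y. y \<in> f ` A \<Longrightarrow> card {a \<in> A. f a = y} \<le> K"
  shows "card A \<le> K * card (f ` A)"
proof -
  have "card A = (\<Sum>y\<in>f ` A. card {a \<in> A. f a = y})"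
    using sum.image_gen[OF \<open>finite A\<close>, of "\<lambda>_. 1 :: nat" f] by simp
  also have "\<dots> \<le> (\<Sum>y\<in>f ` A. K)"
    by (intro sum_mono fibre)
  finally show ?thesis by (simp add: mult.commute)
qed

context free_basis
begin

definition centralizer where
  "centralizer h = {c \<in> carrier F. c \<otimes> h = h \<otimes> c}"

text \<open>If nothing cancels in \<open>h c\<close>, comparing lengths shows that nothing cancels in \<open>c h\<close> either.
  Both \<open>c h\<close> and \<open>h c\<close> are then concatenations giving the same word, so the shorter factor \<open>h\<close> is a
  prefix of \<open>c\<close>.\<close>

lemma centralizer_split_prefix:
  assumes h: "h \<in> carrier F" "cyclically_reduced (nf h)"
    and c: "c \<in> centralizer h" "length (nf h) \<le> length (nf c)"
    and seam: "hd (nf c) \<noteq> inv_letter (last (nf h))"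
  shows "\<exists>c'\<in>centralizer h. c = h \<otimes> c' \<and> length (nf c') + length (nf h) = length (nf c)"
proof -
  have C: "c \<in> carrier F" "c \<otimes> h = h \<otimes> c" using c by (auto simp: centralizer_def)
  note nfh = nf_props[OF h(1)] and nfc = nf_props[OF C(1)]
  have hc: "nf (h \<otimes> c) = nf h @ nf c"
    using nfh nfc seam by (intro nf_mult_no_cancel h C) (auto simp: reduced_append)
  have ch: "nf (h \<otimes> c) = nf c @ nf h"
    using nf_mult_of_length[OF C(1) h(1)] hc by (simp add: C(2))
  define v where "v = drop (length (nf h)) (nf c)"
  have v: "nf c = nf h @ v"
  proof -
    have "take (length (nf h)) (nf c @ nf h) = nf h"
      using hc ch by (metis append_eq_conv_conj)
    then have "take (length (nf h)) (nf c) = nf h" using c(2) by simp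
    then show ?thesis by (metis append_take_drop_id v_def)
  qed
  have vS: "v \<in> words S" "reduced v" using nfc unfolding v by (auto simp: reduced_append)
  have ceq: "c = h \<otimes> val v"
    using nfc(3) nfh vS unfolding v by (simp add: val_append)
  have "h \<otimes> (val v \<otimes> h) = h \<otimes> (h \<otimes> val v)"
    using C h(1) vS by (simp add: ceq m_assoc)
  then have "val v \<otimes> h = h \<otimes> val v" using h(1) vS by simp
  then show ?thesis using ceq vS v by (intro bexI[of _ "val v"]) (auto simp: centralizer_def)
qed

lemma centralizer_inv: "h \<in> carrier F \<Longrightarrow> centralizer (inv h) = centralizer h"
proof -
  have "c \<in> centralizer (inv h)" if "h \<in> carrier F" "c \<in> centralizer h" for h c
  proof -
    have C: "c \<in> carrier F" "c \<otimes> h = h \<otimes> c" using that by (auto simp: centralizer_def)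
    have "inv h \<otimes> c = inv h \<otimes> (c \<otimes> h) \<otimes> inv h"
      using that(1) C(1) by (simp add: m_assoc)
    also have "\<dots> = c \<otimes> inv h"
      unfolding C(2) using that(1) C(1) by (simp add: m_assoc[symmetric])
    finally have "c \<otimes> inv h = inv h \<otimes> c" ..
    then show ?thesis using C by (simp add: centralizer_def)
  qed
  then show "h \<in> carrier F \<Longrightarrow> centralizer (inv h) = centralizer h"
    by (metis inv_closed inv_inv subsetI subset_antisym)
qed

text \<open>For cyclically reduced \<open>h\<close>, cancellation cannot occur in both \<open>h c\<close> and \<open>h\<inverse> c\<close>, so one of
  \<open>h\<close>, \<open>h\<inverse>\<close> can be split off from a long \<open>c\<close> and the rest is shorter. Geometrically, \<open>c\<close> translates
  along the axis of \<open>h\<close>.\<close>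

lemma centralizer_eq_power_mult:
  assumes h: "h \<in> carrier F" "cyclically_reduced (nf h)"
    and "c \<in> centralizer h"
  shows "\<exists>m::int. \<exists>d\<in>carrier F. \<bar>m\<bar> \<le> int (length (nf c)) \<and> length (nf d) < length (nf h) \<and> c = h [^] m \<otimes> d"
  using assms(3)
proof (induction "length (nf c)" arbitrary: c rule: less_induct)
  case less
  have C: "c \<in> carrier F" using less.prems by (simp add: centralizer_def)
  have L: "length (nf h) > 0" using h by (auto simp: cyclically_reduced_def)
  show ?case
  proof (cases "length (nf c) < length (nf h)")
    case True
    then show ?thesis using C by (intro exI[of _ 0] bexI[of _ c]) auto
  next
    case False
    \<comment> \<open>\<open>k\<close> is the one of \<open>h\<close>, \<open>h\<inverse>\<close> that does not cancel against \<open>c\<close>.\<close>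
    define k where "k = (if hd (nf c) \<noteq> inv_letter (last (nf h)) then h else inv h)"
    define e :: int where "e = (if hd (nf c) \<noteq> inv_letter (last (nf h)) then 1 else -1)"
    have k: "k \<in> carrier F" "k = h [^] e"
      using h(1) by (auto simp: k_def e_def int_pow_neg)
    have "cyclically_reduced (nf k)"
      using h by (auto simp: k_def nf_inv intro: cyclically_reduced_inv_word)
    moreover have "c \<in> centralizer k" "length (nf k) = length (nf h)"
      using h(1) less.prems by (auto simp: k_def centralizer_inv nf_inv)
    moreover have "hd (nf c) \<noteq> inv_letter (last (nf k))"
      using h L by (auto simp: k_def nf_inv last_inv_word cyclically_reduced_def)
    ultimately obtain c' where c': "c' \<in> centralizer k" "c = k \<otimes> c'"
        "length (nf c') + length (nf h) = length (nf c)"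
      using centralizer_split_prefix[of k c] k False by auto
    have "centralizer k = centralizer h" using h(1) by (simp add: k_def centralizer_inv)
    with c'(1) have ch: "c' \<in> centralizer h" by (simp only:)
    have "length (nf c') < length (nf c)" using c'(3) L by linarith
    from less.hyps[OF this ch] obtain m d where md: "d \<in> carrier F" "\<bar>m\<bar> \<le> int (length (nf c'))"
      "length (nf d) < length (nf h)" "c' = h [^] m \<otimes> d" by (elim exE bexE conjE) rule
    have "c = h [^] (e + m) \<otimes> d"
      using h(1) md(1) by (simp add: c'(2) md(4) k(2) int_pow_mult m_assoc)
    moreover have "\<bar>e\<bar> \<le> 1" by (simp add: e_def)
    then have "\<bar>e + m\<bar> \<le> int (length (nf c))"
      using md(2) c'(3) L \<open>\<bar>e\<bar> \<le> 1\<close> by linarith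
    ultimately show ?thesis using md by blast
  qed
qed

lemma cyclically_reduced_conjugate:
  assumes "h \<in> carrier F" "h \<noteq> \<one>"
  shows "\<exists>p\<in>carrier F. \<exists>h0\<in>carrier F. cyclically_reduced (nf h0) \<and> h = p \<otimes> h0 \<otimes> inv p"
  using assms
proof (induction "length (nf h)" arbitrary: h rule: less_induct)
  case less
  note nfh = nf_props[OF less.prems(1)]
  have ne: "nf h \<noteq> []" using less.prems nf_eq_Nil_iff by auto
  show ?case
  proof (cases "cyclically_reduced (nf h)")
    case True
    then show ?thesis using less.prems by (intro bexI[of _ \<one>] bexI[of _ h]) auto
  next
    case False
    then have hd: "hd (nf h) = inv_letter (last (nf h))" using ne by (simp add: cyclically_reduced_def)
    obtain l u where lu: "nf h = l # u" using ne by (cases "nf h") auto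
    have "u \<noteq> []" using lu hd by auto
    then obtain v where v: "nf h = l # v @ [inv_letter l]"
      using lu hd by (cases u rule: rev_cases) (auto simp: inv_letter_eq_swap)
    have w: "l \<in> letters" "v \<in> words S" "reduced v"
      using nfh unfolding v by (auto simp: reduced_Cons reduced_append)
    have "v \<noteq> []" using nfh unfolding v by (auto simp: reduced_Cons)
    then have "val v \<noteq> \<one>" using nf_val[OF w(2,3)] by auto
    moreover have "length (nf (val v)) < length (nf h)" using w v by simp
    ultimately obtain p h0 where p: "p \<in> carrier F" "h0 \<in> carrier F" "cyclically_reduced (nf h0)"
        "val v = p \<otimes> h0 \<otimes> inv p"
      using less.hyps[of "val v"] w by auto
    have "h = letter_value F l \<otimes> (val v \<otimes> inv (letter_value F l))"
      using nfh(3) w unfolding v by (simp add: val_append letter_value_inv del: mem_Times_iff)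
    also have "\<dots> = (letter_value F l \<otimes> p) \<otimes> h0 \<otimes> inv (letter_value F l \<otimes> p)"
      using w p by (simp add: m_assoc inv_mult_group del: mem_Times_iff)
    finally show ?thesis using w p by (metis letter_value_closed m_closed)
  qed
qed

end

context finite_free_basis
begin

lemma card_ball_centralizer_cyclically_reduced:
  assumes h: "h \<in> carrier F" "cyclically_reduced (nf h)"
  shows "card (ball (centralizer h) r) \<le> (2 * r + 1) * card (ball (carrier F) (length (nf h)))"
proof -
  let ?A = "{- int r .. int r} \<times> ball (carrier F) (length (nf h))"
  have "ball (centralizer h) r \<subseteq> (\<lambda>(m, d). h [^] m \<otimes> d) ` ?A"
  proof
    fix c assume c: "c \<in> ball (centralizer h) r"
    obtain m :: int and d where "d \<in> carrier F" "\<bar>m\<bar> \<le> int (length (nf c))"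
        "length (nf d) < length (nf h)" "c = h [^] m \<otimes> d"
      using centralizer_eq_power_mult[OF h, of c] c by (auto simp: ball_def)
    then show "c \<in> (\<lambda>(m, d). h [^] m \<otimes> d) ` ?A"
      using c by (intro image_eqI[of _ _ "(m, d)"]) (auto simp: ball_def)
  qed
  moreover have fin: "finite ?A" by (simp add: finite_ball)
  ultimately have "card (ball (centralizer h) r) \<le> card ?A"
    by (meson card_image_le card_mono finite_imageI order_trans)
  also have "card ?A = (2 * r + 1) * card (ball (carrier F) (length (nf h)))"
    by (simp add: card_cartesian_product nat_add_distrib nat_mult_distrib)
  finally show ?thesis .
qed

text \<open>Conjugating into cyclically reduced position changes lengths by a bounded amount only.\<close>

lemma card_ball_centralizer_linear:
  assumes h: "h \<in> carrier F" "h \<noteq> \<one>"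
  shows "\<exists>K. \<forall>r. card (ball (centralizer h) r) \<le> K * (r + 1)"
proof -
  obtain p h0 where p: "p \<in> carrier F" "h0 \<in> carrier F" "cyclically_reduced (nf h0)"
      "h = p \<otimes> h0 \<otimes> inv p"
    using cyclically_reduced_conjugate[OF h] by auto
  let ?L = "2 * length (nf p)"
  let ?f = "\<lambda>c. inv p \<otimes> c \<otimes> p"
  define K where "K = (2 * ?L + 2) * card (ball (carrier F) (length (nf h0)))"
  have "card (ball (centralizer h) r) \<le> K * (r + 1)" for r
  proof -
    have inj: "inj_on ?f (ball (centralizer h) r)"
      using p(1) by (intro inj_onI) (auto simp: ball_def centralizer_def)
    have "?f c \<in> ball (centralizer h0) (r + ?L)" if "c \<in> ball (centralizer h) r" for c
    proof -
      have c: "c \<in> carrier F" "c \<otimes> h = h \<otimes> c" "length (nf c) \<le> r"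
        using that by (auto simp: ball_def centralizer_def)
      have h0: "h0 = inv p \<otimes> h \<otimes> p"
        using p by (simp add: m_assoc) (simp add: m_assoc[symmetric])
      have "?f c \<otimes> h0 = inv p \<otimes> (c \<otimes> h) \<otimes> p"
        unfolding h0 using p(1) c(1) h(1) by (simp add: m_assoc) (simp add: m_assoc[symmetric])
      also have "\<dots> = h0 \<otimes> ?f c"
        unfolding h0 c(2) using p(1) c(1) h(1) by (simp add: m_assoc) (simp add: m_assoc[symmetric])
      finally have "?f c \<in> centralizer h0" using p(1) c(1) by (simp add: centralizer_def)
      moreover have "length (nf (?f c)) \<le> r + ?L"
        using length_nf_mult_le[of "inv p \<otimes> c" p] length_nf_mult_le[of "inv p" c] p(1) c
        by (simp add: length_nf_inv)
      ultimately show ?thesis by (simp add: ball_def)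
    qed
    then have "?f ` ball (centralizer h) r \<subseteq> ball (centralizer h0) (r + ?L)" by auto
    then have "card (ball (centralizer h) r) \<le> card (ball (centralizer h0) (r + ?L))"
      by (intro card_inj_on_le[OF inj] finite_ball) (auto simp: centralizer_def)
    also have "\<dots> \<le> (2 * (r + ?L) + 1) * card (ball (carrier F) (length (nf h0)))"
      by (rule card_ball_centralizer_cyclically_reduced[OF p(2,3)])
    also have "\<dots> \<le> (2 * ?L + 2) * (r + 1) * card (ball (carrier F) (length (nf h0)))"
      by (rule mult_le_mono1) simp
    finally show ?thesis unfolding K_def by (simp only: ac_simps)
  qed
  then show ?thesis by blast
qed

text \<open>The fibres of \<open>g \<mapsto> g h g\<inverse>\<close> on a ball are contained in cosets of the centralizer of \<open>h\<close>, hence have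
  linear size, whereas the image lies in a ball of twice the radius. The linear factor is
  absorbed into an arbitrarily small exponential one.\<close>

lemma half_poincare_exponent_le_normal:
  assumes G: "subgroup G F" and N: "N \<lhd> F\<lparr>carrier := G\<rparr>" and nontrivial: "N \<noteq> {\<one>}"
  shows "ereal (1 / 2) * poincare_exponent F S G \<le> poincare_exponent F S N"
proof -
  interpret GG: group "F\<lparr>carrier := G\<rparr>" by (rule subgroup.subgroup_is_group[OF G is_group])
  have GF: "G \<subseteq> carrier F" using G by (rule subgroup.subset)
  have Nsub: "subgroup N (F\<lparr>carrier := G\<rparr>)" using N by (rule normal_imp_subgroup)
  then have NG: "N \<subseteq> G" "\<one> \<in> N" using subgroup.subset subgroup.one_closed by fastforce+
  then have NF: "N \<subseteq> carrier F" using GF by auto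
  obtain h where h: "h \<in> N" "h \<noteq> \<one>" using nontrivial NG by blast
  have hF: "h \<in> carrier F" using h NF by auto
  have conj: "g \<otimes> h \<otimes> inv g \<in> N" if "g \<in> G" for g
    using normal.inv_op_closed2[OF N, of g h] that h m_inv_consistent[OF G] by simp
  obtain K where K: "\<And>r. card (ball (centralizer h) r) \<le> K * (r + 1)"
    using card_ball_centralizer_linear[OF hF h(2)] by auto
  let ?L = "length (nf h)"
  let ?f = "\<lambda>g. g \<otimes> h \<otimes> inv g"
  have count: "card (ball G r) \<le> K * (2 * r + 1) * card (ball N (2 * r + ?L))" for r
  proof -
    have img: "?f ` ball G r \<subseteq> ball N (2 * r + ?L)"
    proof
      fix x assume "x \<in> ?f ` ball G r"
      then obtain g where g: "g \<in> G" "length (nf g) \<le> r" "x = ?f g" by (auto simp: ball_def)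
      have gF: "g \<in> carrier F" using g GF by auto
      have "length (nf x) \<le> 2 * r + ?L"
        using length_nf_mult_le[of "g \<otimes> h" "inv g"] length_nf_mult_le[of g h] gF hF g
        by (simp add: length_nf_inv)
      with conj g show "x \<in> ball N (2 * r + ?L)" by (simp add: ball_def)
    qed
    have "card {g \<in> ball G r. ?f g = y} \<le> K * (2 * r + 1)" if y: "y \<in> ?f ` ball G r" for y
    proof -
      obtain g0 where g0: "g0 \<in> G" "length (nf g0) \<le> r" "y = ?f g0" using y by (auto simp: ball_def)
      have g0F: "g0 \<in> carrier F" using g0 GF by auto
      have "inv g0 \<otimes> g \<in> ball (centralizer h) (2 * r)" if "g \<in> ball G r" "?f g = y" for g
      proof -
        have gF: "g \<in> carrier F" "length (nf g) \<le> r" using that GF by (auto simp: ball_def)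
        have "inv g0 \<otimes> g \<otimes> h = inv g0 \<otimes> ?f g \<otimes> g"
          using g0F gF hF by (simp add: m_assoc)
        also have "\<dots> = inv g0 \<otimes> ?f g0 \<otimes> g" using that g0 by simp
        also have "\<dots> = h \<otimes> (inv g0 \<otimes> g)"
          using g0F gF hF by (simp add: m_assoc) (simp add: m_assoc[symmetric])
        finally have "inv g0 \<otimes> g \<in> centralizer h" using g0F gF by (simp add: centralizer_def)
        moreover have "length (nf (inv g0 \<otimes> g)) \<le> 2 * r"
          using length_nf_mult_le[of "inv g0" g] g0F gF g0 by (simp add: length_nf_inv)
        ultimately show ?thesis by (simp add: ball_def)
      qed
      then have "(\<lambda>g. inv g0 \<otimes> g) ` {g \<in> ball G r. ?f g = y} \<subseteq> ball (centralizer h) (2 * r)" by auto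
      moreover have "inj_on (\<lambda>g. inv g0 \<otimes> g) {g \<in> ball G r. ?f g = y}"
        using g0F GF by (intro inj_onI) (auto simp: ball_def subset_iff)
      ultimately have "card {g \<in> ball G r. ?f g = y} \<le> card (ball (centralizer h) (2 * r))"
        by (intro card_inj_on_le finite_ball) (auto simp: centralizer_def)
      also have "\<dots> \<le> K * (2 * r + 1)" by (rule K)
      finally show ?thesis .
    qed
    then have "card (ball G r) \<le> K * (2 * r + 1) * card (?f ` ball G r)"
      by (intro card_le_card_image_times_fibre finite_ball GF)
    also have "\<dots> \<le> K * (2 * r + 1) * card (ball N (2 * r + ?L))"
      by (intro mult_left_mono card_mono finite_ball NF img) simp
    finally show ?thesis .
  qed
  have upper: "poincare_exponent F S G \<le> ereal (2 * c + e)"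
    if c: "poincare_exponent F S N < ereal c" and e: "e > 0" for c e
  proof -
    obtain r0 where r0: "\<And>r. r \<ge> r0 \<Longrightarrow> real (card (ball N r)) \<le> exp (c * real r)"
      using card_ball_le_of_poincare_exponent_less[OF NF c] by blast
    have c0: "c \<ge> 0"
    proof (rule ccontr)
      assume "\<not> c \<ge> 0"
      have "card (ball N (Suc r0)) \<ge> 1"
        using NG finite_ball[OF NF, of "Suc r0"] card_0_eq[of "ball N (Suc r0)"]
        by (auto simp: ball_def Suc_le_eq card_gt_0_iff)
      then have "1 \<le> real (card (ball N (Suc r0)))" by simp
      also have "\<dots> \<le> exp (c * real (Suc r0))" using r0[of "Suc r0"] by simp
      finally have "0 \<le> c * real (Suc r0)" using one_le_exp_iff by blast
      then show False using \<open>\<not> c \<ge> 0\<close> by (simp add: zero_le_mult_iff)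
    qed
    define C where "C = (real K + 1) * (2 / e + 1) * exp (c * ?L)"
    have "real (card (ball G r)) \<le> C * exp ((2 * c + e) * real r)" if "r \<ge> r0" for r
    proof -
      have "real (card (ball G r)) \<le> real (K * (2 * r + 1) * card (ball N (2 * r + ?L)))"
        using count[of r] by (simp only: of_nat_le_iff)
      also have "\<dots> = real K * (2 * real r + 1) * real (card (ball N (2 * r + ?L)))" by (simp add: algebra_simps)
      also have "\<dots> \<le> (real K + 1) * ((2 / e + 1) * exp (e * real r)) * exp (c * real (2 * r + ?L))"
      proof (intro mult_mono)
        have le_exp: "e * real r \<le> exp (e * real r)"
          using exp_ge_add_one_self[of "e * real r"] by linarith
        have "2 * real r = 2 / e * (e * real r)" using e by simp
        also have "\<dots> \<le> 2 / e * exp (e * real r)"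
          using e mult_left_mono[OF le_exp, of "2 / e"] by simp
        finally have "2 * real r \<le> 2 / e * exp (e * real r)" .
        moreover have "1 \<le> exp (e * real r)" using e by simp
        ultimately show "2 * real r + 1 \<le> (2 / e + 1) * exp (e * real r)"
          unfolding distrib_right mult_1_left by linarith
        show "real (card (ball N (2 * r + ?L))) \<le> exp (c * real (2 * r + ?L))"
          using that by (intro r0) simp
      qed (use e in auto)
      also have "\<dots> = C * exp ((2 * c + e) * real r)"
        by (simp add: C_def algebra_simps exp_add)
      finally show ?thesis .
    qed
    moreover have "C > 0"
      unfolding C_def using e by (intro mult_pos_pos add_nonneg_pos) auto
    ultimately show ?thesis
      using e c0 by (intro poincare_exponent_le[OF GF, of _ C r0]) auto
  qed
  show ?thesis
  proof (rule ereal_le_real)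
    fix z assume z: "poincare_exponent F S N \<le> ereal z"
    have "poincare_exponent F S G \<le> ereal (2 * z) + ereal e" if "e > 0" for e
    proof -
      have "poincare_exponent F S N < ereal (z + e / 3)"
        by (rule le_less_trans[OF z]) (use that in simp)
      from upper[OF this, of "e / 3"] that
      have "poincare_exponent F S G \<le> ereal (2 * (z + e / 3) + e / 3)" by simp
      also have "2 * (z + e / 3) + e / 3 = 2 * z + e" by simp
      finally show ?thesis by simp
    qed
    then have "poincare_exponent F S G \<le> ereal (2 * z)"
      by (rule ereal_le_epsilon2) auto
    then show "ereal (1 / 2) * poincare_exponent F S G \<le> ereal z"
      by (cases "poincare_exponent F S G") auto
  qed
qed

end

section \<open>Normal subgroups of the free group with small exponent\<close>

text \<open>A list of pairs \<open>(s, j)\<close> with \<open>0 < j < k\<close> and distinct neighbouring \<open>s\<close> is a normal form in the free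
  product of cyclic groups of order \<open>k\<close>, head first. Such lists are the vertices of a cactus graph:
  every vertex \<open>y\<close> lies on one \<open>k\<close>-cycle for each generator \<open>s\<close>. On that cycle, \<open>cycle_base s y\<close> is the
  vertex nearest to the root \<open>[]\<close>, and \<open>cycle_pos s y\<close> counts the steps from there;
  \<open>cycle_vertex\<close> recovers the vertex from these two coordinates.\<close>

definition cycle_pos :: "'a \<Rightarrow> ('a \<times> nat) list \<Rightarrow> nat" where
  "cycle_pos s y = (if y \<noteq> [] \<and> fst (hd y) = s then snd (hd y) else 0)"

definition cycle_base :: "'a \<Rightarrow> ('a \<times> nat) list \<Rightarrow> ('a \<times> nat) list" where
  "cycle_base s y = (if y \<noteq> [] \<and> fst (hd y) = s then tl y else y)"

definition cycle_vertex :: "'a \<Rightarrow> nat \<Rightarrow> ('a \<times> nat) list \<Rightarrow> ('a \<times> nat) list" where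
  "cycle_vertex s j z = (if j = 0 then z else (s, j) # z)"

fun normal_form :: "nat \<Rightarrow> ('a \<times> nat) list \<Rightarrow> bool" where
  "normal_form k [] = True"
| "normal_form k ((s, j) # z) = (0 < j \<and> j < k \<and> cycle_pos s z = 0 \<and> normal_form k z)"

text \<open>The inverse letter goes around the cycle in the opposite direction. Its step is \<open>k - 1\<close>
  rather than \<open>- 1\<close>, because positions are natural numbers taken modulo \<open>k\<close>.\<close>

definition letter_step :: "nat \<Rightarrow> 'a \<times> bool \<Rightarrow> ('a \<times> nat) list \<Rightarrow> ('a \<times> nat) list" where
  "letter_step k l y = cycle_vertex (fst l) ((cycle_pos (fst l) y + (if snd l then 1 else k - 1)) mod k) (cycle_base (fst l) y)"

definition word_action :: "nat \<Rightarrow> ('a \<times> bool) list \<Rightarrow> ('a \<times> nat) list \<Rightarrow> ('a \<times> nat) list" where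
  "word_action k w y = foldr (letter_step k) w y"

lemma base_of_pos_0: "normal_form k z \<Longrightarrow> cycle_pos s z = 0 \<Longrightarrow> cycle_base s z = z"
  by (cases z) (auto simp: cycle_pos_def cycle_base_def split: if_splits)

lemma normal_form_split:
  assumes "normal_form k y"
  shows "normal_form k (cycle_base s y)" "cycle_pos s (cycle_base s y) = 0" "cycle_vertex s (cycle_pos s y) (cycle_base s y) = y"
    "0 < k \<Longrightarrow> cycle_pos s y < k"
  using assms by (cases y; force simp: cycle_pos_def cycle_base_def cycle_vertex_def)+

lemma cycle_vertex_coordinates:
  assumes "normal_form k z" "cycle_pos s z = 0" "j < k"
  shows "normal_form k (cycle_vertex s j z)" "cycle_pos s (cycle_vertex s j z) = j" "cycle_base s (cycle_vertex s j z) = z"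
  using assms base_of_pos_0[OF assms(1,2)] by (auto simp: cycle_vertex_def cycle_pos_def cycle_base_def)

lemma pos_cycle_vertex_other: "t \<noteq> s \<Longrightarrow> j \<noteq> 0 \<Longrightarrow> cycle_pos t (cycle_vertex s j z) = 0"
  by (simp add: cycle_vertex_def cycle_pos_def)

lemma letter_step_coordinates:
  assumes "normal_form k y" "0 < k"
  shows "normal_form k (letter_step k l y)" "cycle_base (fst l) (letter_step k l y) = cycle_base (fst l) y"
    "cycle_pos (fst l) (letter_step k l y) = (cycle_pos (fst l) y + (if snd l then 1 else k - 1)) mod k"
  unfolding letter_step_def
  using cycle_vertex_coordinates[OF normal_form_split(1,2)[OF assms(1), of "fst l"]] assms(2)
  by auto

lemma letter_step_inv_letter:
  assumes "normal_form k y" "0 < k"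
  shows "letter_step k (inv_letter l) (letter_step k l y) = y"
proof -
  let ?s = "fst l"
  let ?e = "if snd l then 1 else k - 1" and ?e' = "if snd l then k - 1 else 1"
  have "(cycle_pos ?s y + ?e + ?e') mod k = cycle_pos ?s y"
    using normal_form_split(4)[OF assms, of ?s] assms(2) by (auto simp: algebra_simps)
  then have "((cycle_pos ?s y + ?e) mod k + ?e') mod k = cycle_pos ?s y"
    by (simp only: mod_add_left_eq)
  moreover have "letter_step k (inv_letter l) (letter_step k l y) =
      cycle_vertex ?s (((cycle_pos ?s y + ?e) mod k + ?e') mod k) (cycle_base ?s y)"
    using letter_step_coordinates[OF assms, of l]
    by (subst letter_step_def) (simp add: inv_letter_def)
  ultimately show ?thesis using normal_form_split(3)[OF assms(1), of ?s] by simp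
qed

lemma word_action_Nil [simp]: "word_action k [] y = y"
  and word_action_Cons [simp]: "word_action k (l # w) y = letter_step k l (word_action k w y)"
  and word_action_append: "word_action k (u @ v) y = word_action k u (word_action k v y)"
  by (simp_all add: word_action_def)

lemma normal_form_word_action: "normal_form k y \<Longrightarrow> 0 < k \<Longrightarrow> normal_form k (word_action k w y)"
  by (induction w) (auto simp: letter_step_coordinates)

lemma word_action_cons_reduce:
  assumes "normal_form k y" "0 < k"
  shows "word_action k (cons_reduce l w) y = word_action k (l # w) y"
proof (cases "w \<noteq> [] \<and> hd w = inv_letter l")
  case True
  then obtain v where "w = inv_letter l # v" by (cases w) auto
  then show ?thesis
    using letter_step_inv_letter[OF normal_form_word_action[OF assms, of v] assms(2), of "inv_letter l"]
    by (simp add: cons_reduce_def)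
next
  case False
  then show ?thesis unfolding cons_reduce_def by (subst if_not_P) auto
qed

lemma word_action_replicate:
  assumes "normal_form k y" "0 < k"
  shows "word_action k (replicate m l) y =
    cycle_vertex (fst l) ((cycle_pos (fst l) y + m * (if snd l then 1 else k - 1)) mod k) (cycle_base (fst l) y)"
proof (induction m)
  case 0
  then show ?case using normal_form_split[OF assms(1), of "fst l"] assms(2) by simp
next
  case (Suc m)
  define e where "e = (if snd l then 1 else k - 1)"
  have "((cycle_pos (fst l) y + m * e) mod k + e) mod k = (cycle_pos (fst l) y + Suc m * e) mod k"
    unfolding mod_add_left_eq by (simp add: algebra_simps)
  then show ?case
    using cycle_vertex_coordinates[OF normal_form_split(1,2)[OF assms(1), of "fst l"]] assms(2)
    unfolding word_action_Cons replicate_Suc Suc letter_step_def e_def[symmetric] by simp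
qed

lemma word_action_replicate_order:
  assumes "normal_form k y" "0 < k"
  shows "word_action k (replicate k l) y = y"
  using normal_form_split[OF assms(1), of "fst l"] assms(2) by (simp add: word_action_replicate[OF assms])

context free_basis
begin

text \<open>The action is defined on words; this makes it an action of the group, because free reduction
  deletes only pairs of letters that act as mutually inverse permutations.\<close>

lemma word_action_nf_val:
  assumes "w \<in> words S" "normal_form k y" "0 < k"
  shows "word_action k (nf (val w)) y = word_action k w y"
  using assms(1)
proof (induction w)
  case (Cons l w)
  then show ?case
    using assms by (simp add: nf_letter_mult word_action_cons_reduce del: mem_Times_iff)
qed simp

lemma word_action_nf_mult:
  assumes "x \<in> carrier F" "x' \<in> carrier F" "normal_form k y" "0 < k"
  shows "word_action k (nf (x \<otimes> x')) y = word_action k (nf x) (word_action k (nf x') y)"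
proof -
  have "x \<otimes> x' = val (nf x @ nf x')"
    using nf_props[OF assms(1)] nf_props[OF assms(2)] by (simp add: val_append)
  moreover have "nf x @ nf x' \<in> words S"
    using nf_props[OF assms(1)] nf_props[OF assms(2)] by simp
  ultimately show ?thesis using word_action_nf_val assms(3,4) by (simp add: word_action_append)
qed

definition action_kernel where
  "action_kernel k = {x \<in> carrier F. \<forall>y. normal_form k y \<longrightarrow> word_action k (nf x) y = y}"

lemma normal_action_kernel:
  assumes k: "0 < k"
  shows "action_kernel k \<lhd> F"
proof (rule normal_invI)
  have inv_act: "word_action k (nf (inv x)) (word_action k (nf x) y) = y" if "x \<in> carrier F" "normal_form k y" for x y
    using word_action_nf_mult[OF inv_closed[OF that(1)] that(1) that(2) k] that(1) by simp
  show "subgroup (action_kernel k) F"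
  proof (rule subgroupI)
    show "inv x \<in> action_kernel k" if "x \<in> action_kernel k" for x
      using that inv_act by (auto simp: action_kernel_def) metis
    show "action_kernel k \<noteq> {}" by (auto simp: action_kernel_def intro!: exI[of _ \<one>])
  qed (auto simp: action_kernel_def word_action_nf_mult k)
  show "g \<otimes> x \<otimes> inv g \<in> action_kernel k" if "x \<in> action_kernel k" "g \<in> carrier F" for x g
  proof -
    have x: "x \<in> carrier F" "\<And>y. normal_form k y \<Longrightarrow> word_action k (nf x) y = y"
      using that by (auto simp: action_kernel_def)
    have "word_action k (nf (g \<otimes> x \<otimes> inv g)) y = y" if y: "normal_form k y" for y
    proof -
      have y': "normal_form k (word_action k (nf (inv g)) y)" by (rule normal_form_word_action[OF y k])
      have "word_action k (nf (g \<otimes> x \<otimes> inv g)) y = word_action k (nf g) (word_action k (nf x) (word_action k (nf (inv g)) y))"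
        using x(1) \<open>g \<in> carrier F\<close> y y' k by (simp add: word_action_nf_mult)
      also have "\<dots> = y"
        using inv_act[of "inv g" y] \<open>g \<in> carrier F\<close> y by (simp add: x(2)[OF y'])
      finally show ?thesis .
    qed
    with x(1) \<open>g \<in> carrier F\<close> show ?thesis by (simp add: action_kernel_def)
  qed
qed

lemma val_power_in_action_kernel:
  assumes "l \<in> letters" "0 < k"
  shows "val (replicate k l) \<in> action_kernel k"
proof -
  have w: "replicate k l \<in> words S" using assms(1) by (simp add: words_def in_lists_conv_set del: mem_Times_iff)
  then show ?thesis
    using assms(2) by (simp add: action_kernel_def word_action_nf_val word_action_replicate_order)
qed

end

text \<open>The weight of a vertex is multiplicative along the chain of cycles leading to it
  from the root.\<close>

definition vertex_weight :: "(nat \<Rightarrow> real) \<Rightarrow> ('a \<times> nat) list \<Rightarrow> real" where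
  "vertex_weight \<phi> y = prod_list (map (\<lambda>(s, j). \<phi> j) y)"

lemma vertex_weight_Nil [simp]: "vertex_weight \<phi> [] = 1"
  and vertex_weight_Cons [simp]: "vertex_weight \<phi> ((s, j) # z) = \<phi> j * vertex_weight \<phi> z"
  by (simp_all add: vertex_weight_def)

text \<open>Position on the cycle of the letter \<open>l\<close>, counted in the direction in which \<open>l\<close> moves. It
  exploits the reflection symmetry of a cycle to treat a generator and its inverse alike.\<close>

definition directed_pos :: "nat \<Rightarrow> 'a \<times> bool \<Rightarrow> ('a \<times> nat) list \<Rightarrow> nat" where
  "directed_pos k l y = (if snd l then cycle_pos (fst l) y else (k - cycle_pos (fst l) y) mod k)"

text \<open>An edge is addressed by the vertex \<open>y\<close> where it starts and its letter, so the last edge of the walk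
  \<open>l # w\<close> starts at \<open>word_action k w []\<close>.\<close>

definition edge_weight ::
  "nat \<Rightarrow> (nat \<Rightarrow> real) \<Rightarrow> (nat \<Rightarrow> real) \<Rightarrow> 'a \<times> bool \<Rightarrow> ('a \<times> nat) list \<Rightarrow> real" where
  "edge_weight k a \<phi> l y = vertex_weight \<phi> (cycle_base (fst l) y) * a (directed_pos k l y)"

lemma directed_pos_step:
  assumes "normal_form k y" "0 < k"
  shows "directed_pos k l (letter_step k l y) = (directed_pos k l y + 1) mod k"
proof -
  let ?p = "cycle_pos (fst l) y"
  have p: "?p < k" using normal_form_split(4)[OF assms] .
  show ?thesis
  proof (cases "snd l \<or> ?p = 0")
    case True
    then show ?thesis using letter_step_coordinates(3)[OF assms, of l] assms(2) p
      by (auto simp: directed_pos_def)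
  next
    case False
    then obtain p' where p': "?p = Suc p'" by (cases ?p) auto
    have "(?p + (k - 1)) mod k = p'"
      using p p' by (simp add: mod_if)
    then show ?thesis
      using False letter_step_coordinates(3)[OF assms, of l] assms(2) p p' by (auto simp: directed_pos_def Suc_diff_Suc)
  qed
qed

text \<open>The three inequalities say that the edge weights leaving the end of an edge, except by
  backtracking, sum to at most \<open>lam\<close> times the weight of that edge. \<open>along\<close> treats an edge inside a
  cycle; the two others treat the edge that closes a cycle at its base vertex, according to
  whether that base vertex is an inner vertex of a cycle of another generator. In that case the parent
  cycle contributes \<open>(a i + a (k - i)) / \<phi> i\<close> times the weight of the base vertex. The choice of \<open>\<phi>\<close> makes this the constant
  \<open>1 / \<beta>\<close>, independently of \<open>i\<close>, so a single inequality suffices.\<close>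

locale cactus_weights = finite_free_basis +
  fixes k :: nat and a \<phi> :: "nat \<Rightarrow> real" and \<beta> lam :: real
  assumes k: "k \<ge> 2" and two_gens: "card S \<ge> 2"
    and a_pos: "\<And>j. 0 < a j" and beta: "\<beta> > 0" and lam1: "lam > 1"
    and phi: "\<And>j. 0 < j \<Longrightarrow> j < k \<Longrightarrow> \<phi> j = \<beta> * (a j + a (k - j))"
    and along: "\<And>j. 0 < j \<Longrightarrow> j < k \<Longrightarrow> a j + (2 * real (card S) - 2) * \<phi> j * a 0 \<le> lam * a (j - 1)"
    and closing: "(2 * real (card S) - 3) * a 0 + 1 / \<beta> \<le> lam * a (k - 1)"
    and closing_root: "(2 * real (card S) - 1) * a 0 \<le> lam * a (k - 1)"
begin

lemma k0: "0 < k" using k by simp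

lemma phi_pos: "0 < j \<Longrightarrow> j < k \<Longrightarrow> 0 < \<phi> j"
  using a_pos beta by (simp add: phi add_pos_pos)

lemma phi_sym: "0 < j \<Longrightarrow> j < k \<Longrightarrow> \<phi> (k - j) = \<phi> j"
  using phi[of j] phi[of "k - j"] by (simp add: add.commute)

lemma vertex_weight_pos: "normal_form k y \<Longrightarrow> vertex_weight \<phi> y > 0"
proof (induction y)
  case (Cons p y)
  then show ?case by (cases p) (simp add: phi_pos)
qed simp

abbreviation D where "D \<equiv> edge_weight k a \<phi>"

lemma D_pos: "normal_form k y \<Longrightarrow> D l y > 0"
  by (simp add: edge_weight_def vertex_weight_pos normal_form_split a_pos)

lemma D_pair_of_pos_0:
  assumes "normal_form k y" "cycle_pos t y = 0"
  shows "D (t, True) y + D (t, False) y = 2 * (vertex_weight \<phi> y * a 0)"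
  using base_of_pos_0[OF assms] assms by (simp add: edge_weight_def directed_pos_def)

lemma next_edges_eq:
  assumes "l \<in> letters"
  shows "(\<Sum>l'\<in>letters - {inv_letter l}. D l' y) =
    D l y + (\<Sum>t\<in>S - {fst l}. D (t, True) y + D (t, False) y)"
proof -
  have eq: "letters - {inv_letter l} = insert l ((S - {fst l}) \<times> UNIV)"
    using assms by (cases l) (auto simp: inv_letter_def)
  have "(\<Sum>l'\<in>(S - {fst l}) \<times> UNIV. D l' y) = (\<Sum>t\<in>S - {fst l}. \<Sum>b\<in>UNIV. D (t, b) y)"
    using finite_gens by (simp add: sum.cartesian_product)
  then show ?thesis
    unfolding eq using finite_gens by (subst sum.insert) (auto simp: UNIV_bool add.commute)
qed

lemma edge_weight_supersolution:
  assumes l: "l \<in> letters" and y: "normal_form k y"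
  shows "(\<Sum>l'\<in>letters - {inv_letter l}. D l' (letter_step k l y)) \<le> lam * D l y"
proof -
  define s z p where "s = fst l" and "z = cycle_base s y" and "p = directed_pos k l y"
  let ?y = "letter_step k l y"
  have sS: "s \<in> S" using l by (auto simp: s_def)
  have n: "real (card (S - {s})) = real (card S) - 1"
    using sS two_gens finite_gens by (simp add: card_Diff_singleton of_nat_diff)
  have z: "normal_form k z" "cycle_pos s z = 0" using normal_form_split[OF y] by (auto simp: z_def)
  have y': "normal_form k ?y" "cycle_base s ?y = z" using letter_step_coordinates[OF y k0, of l] by (auto simp: s_def z_def)
  have yput: "?y = cycle_vertex s (cycle_pos s ?y) z" using normal_form_split(3)[OF y'(1), of s] y'(2) by simp
  have p': "directed_pos k l ?y = (p + 1) mod k" unfolding p_def by (rule directed_pos_step[OF y k0])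
  have p: "p < k" using k0 normal_form_split(4)[OF y k0] by (auto simp: p_def directed_pos_def)
  have h: "vertex_weight \<phi> z > 0" by (rule vertex_weight_pos[OF z(1)])
  have Dl: "D l ?y = vertex_weight \<phi> z * a ((p + 1) mod k)" "D l y = vertex_weight \<phi> z * a p"
    using y'(2) p' by (simp_all add: edge_weight_def p_def s_def z_def)
  have cycle_pos': "cycle_pos s ?y < k" using normal_form_split(4)[OF y'(1) k0] .
  \<comment> \<open>The edge either ends at an inner vertex of its cycle or closes the cycle.\<close>
  consider "p + 1 < k" | "p = k - 1" using p by linarith
  then show ?thesis
  proof cases
    case 1
    let ?j = "cycle_pos s ?y"
    have j: "?j = p + 1 \<or> ?j = k - (p + 1)" "?j \<noteq> 0"
      using p' 1 cycle_pos' by (auto simp: directed_pos_def s_def[symmetric] mod_if split: if_splits)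
    have phij: "\<phi> ?j = \<phi> (p + 1)" using j(1) phi_sym[of "p + 1"] 1 by auto
    have "vertex_weight \<phi> ?y = \<phi> (p + 1) * vertex_weight \<phi> z"
      using j(2) phij by (subst yput) (simp add: cycle_vertex_def)
    moreover have "D (t, True) ?y + D (t, False) ?y = 2 * (vertex_weight \<phi> ?y * a 0)" if "t \<in> S - {s}" for t
    proof (rule D_pair_of_pos_0[OF y'(1)])
      show "cycle_pos t ?y = 0" using that j(2) by (subst yput) (auto intro: pos_cycle_vertex_other)
    qed
    ultimately have "(\<Sum>l'\<in>letters - {inv_letter l}. D l' ?y) =
        vertex_weight \<phi> z * (a (p + 1) + (2 * real (card S) - 2) * \<phi> (p + 1) * a 0)"
      unfolding next_edges_eq[OF l] Dl s_def[symmetric] using 1 by (simp add: n algebra_simps)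
    also have "\<dots> \<le> vertex_weight \<phi> z * (lam * a p)"
      using along[of "p + 1"] 1 h by (intro mult_left_mono) auto
    finally show ?thesis by (simp add: Dl mult_ac)
  next
    case 2
    have j: "cycle_pos s ?y = 0"
      using p' 2 k0 cycle_pos' by (auto simp: directed_pos_def s_def[symmetric] mod_if split: if_splits)
    then have yz: "?y = z" using yput by (simp add: cycle_vertex_def)
    have Dlz: "D l z = vertex_weight \<phi> z * a 0" using Dl(1) 2 k0 yz by simp
    show ?thesis
    proof (cases "\<forall>t\<in>S - {s}. cycle_pos t z = 0")
      case True
      then have "(\<Sum>t\<in>S - {s}. D (t, True) z + D (t, False) z) = (\<Sum>t\<in>S - {s}. 2 * (vertex_weight \<phi> z * a 0))"
        by (intro sum.cong refl D_pair_of_pos_0[OF z(1)]) auto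
      then have "(\<Sum>l'\<in>letters - {inv_letter l}. D l' ?y) = vertex_weight \<phi> z * ((2 * real (card S) - 1) * a 0)"
        unfolding next_edges_eq[OF l] yz Dlz s_def[symmetric] by (simp add: n algebra_simps)
      also have "\<dots> \<le> vertex_weight \<phi> z * (lam * a p)"
        using closing_root 2 h by (intro mult_left_mono) auto
      finally show ?thesis by (simp add: Dl mult_ac)
    next
      case False
      then obtain t where t: "t \<in> S" "t \<noteq> s" "cycle_pos t z \<noteq> 0" by auto
      then obtain i z' where Cons: "z = (t, i) # z'"
        by (cases z) (auto simp: cycle_pos_def split: if_splits)
      have i: "0 < i" "i < k" "cycle_pos t z = i" "cycle_base t z = z'"
        using z Cons by (auto simp: cycle_pos_def cycle_base_def)
      have hz: "vertex_weight \<phi> z = \<phi> i * vertex_weight \<phi> z'" by (simp add: Cons)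
      have "D (t, True) z + D (t, False) z = vertex_weight \<phi> z' * (a i + a (k - i))"
        using i by (simp add: edge_weight_def directed_pos_def algebra_simps)
      also have "\<dots> = vertex_weight \<phi> z / \<beta>"
        using beta by (simp add: hz phi i)
      finally have Dt: "D (t, True) z + D (t, False) z = vertex_weight \<phi> z / \<beta>" .
      have Dr: "D (r, True) z + D (r, False) z = 2 * (vertex_weight \<phi> z * a 0)" if "r \<noteq> t" for r
        by (rule D_pair_of_pos_0[OF z(1)]) (use that in \<open>simp add: Cons cycle_pos_def\<close>)
      have "(\<Sum>r\<in>S - {s}. D (r, True) z + D (r, False) z) =
          vertex_weight \<phi> z / \<beta> + (\<Sum>r\<in>S - {s} - {t}. 2 * (vertex_weight \<phi> z * a 0))"
        using finite_gens t by (subst sum.remove[of _ t]) (auto simp: Dt Dr)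
      moreover have "real (card (S - {s} - {t})) = real (card S) - 2"
      proof -
        have "card (S - {s}) = Suc (card (S - {s} - {t}))"
          using t finite_gens by (intro card.remove) auto
        then show ?thesis using n by simp
      qed
      ultimately have "(\<Sum>l'\<in>letters - {inv_letter l}. D l' ?y) =
          vertex_weight \<phi> z * ((2 * real (card S) - 3) * a 0 + 1 / \<beta>)"
        unfolding next_edges_eq[OF l] yz Dlz s_def[symmetric] by (simp add: algebra_simps)
      also have "\<dots> \<le> vertex_weight \<phi> z * (lam * a p)"
        using closing 2 h by (intro mult_left_mono) auto
      finally show ?thesis by (simp add: Dl mult_ac)
    qed
  qed
qed


text \<open>An element of the kernel fixes the root, so its normal form is a closed walk. The last
  edge of such a walk closes a cycle at the root and has weight \<open>a (k - 1)\<close>, a constant.\<close>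

lemma poincare_exponent_action_kernel_le:
  "poincare_exponent F S (action_kernel k) \<le> ereal (ln lam)"
proof -
  define \<Phi> where "\<Phi> w = (case w of [] \<Rightarrow> 0 | l # u \<Rightarrow> D l (word_action k u []))"
    for w :: "('a \<times> bool) list"
  have sub: "action_kernel k \<subseteq> carrier F" by (auto simp: action_kernel_def)
  have "\<exists>C>0. \<forall>r. real (card {w \<in> nf ` action_kernel k. length w \<le> r}) \<le> C * lam ^ r"
  proof (rule card_words_le_of_weight[where \<Phi> = \<Phi> and m = "a (k - 1)"])
    fix w assume w: "w \<in> words S" "reduced w" "w \<noteq> []"
    then obtain l u where lu: "w = l # u" by (cases w) auto
    have "(\<Sum>l'\<in>next_letters w. \<Phi> (l' # w)) = (\<Sum>l'\<in>letters - {inv_letter l}. D l' (letter_step k l (word_action k u [])))"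
      using next_letters_eq[OF w(2,3)] by (simp add: lu \<Phi>_def)
    also have "\<dots> \<le> lam * D l (word_action k u [])"
      using w(1) by (intro edge_weight_supersolution normal_form_word_action k0) (simp_all add: lu del: mem_Times_iff)
    finally show "(\<Sum>l'\<in>next_letters w. \<Phi> (l' # w)) \<le> lam * \<Phi> w" by (simp add: lu \<Phi>_def)
  next
    show "\<Phi> w \<ge> 0" for w
      by (cases w) (auto simp: \<Phi>_def intro!: less_imp_le[OF D_pos] normal_form_word_action k0)
  next
    fix w assume w: "w \<in> nf ` action_kernel k" "w \<noteq> []"
    then obtain l u where lu: "w = l # u" by (cases w) auto
    let ?y = "word_action k u []"
    have ny: "normal_form k ?y" by (intro normal_form_word_action k0) simp
    obtain x where x: "x \<in> action_kernel k" "nf x = l # u" using w lu by auto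
    then have "word_action k (nf x) [] = []" by (simp add: action_kernel_def)
    then have closed: "letter_step k l ?y = []" by (simp add: x(2))
    have "cycle_base (fst l) ?y = []"
      using letter_step_coordinates(2)[OF ny k0, of l] closed by (simp add: cycle_base_def)
    moreover have "(directed_pos k l ?y + 1) mod k = 0"
      unfolding directed_pos_step[OF ny k0, of l, symmetric] closed by (simp add: directed_pos_def cycle_pos_def)
    moreover have "directed_pos k l ?y < k"
      using k0 normal_form_split(4)[OF ny k0] by (auto simp: directed_pos_def)
    moreover from calculation have "directed_pos k l ?y = k - 1"
      by (auto simp: mod_if split: if_splits)
    ultimately have "D l ?y = a (k - 1)"
      by (simp add: edge_weight_def)
    then show "a (k - 1) \<le> \<Phi> w" by (simp add: lu \<Phi>_def)
  qed (use nf_props sub a_pos lam1 in auto)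
  then obtain C where C: "C > 0" "\<And>r. real (card {w \<in> nf ` action_kernel k. length w \<le> r}) \<le> C * lam ^ r"
    by auto
  show ?thesis
  proof (rule poincare_exponent_le[OF sub _ C(1), of _ 0])
    fix r :: nat
    have "{w \<in> nf ` action_kernel k. length w \<le> r} = nf ` ball (action_kernel k) r"
      by (auto simp: ball_def)
    moreover have "inj_on nf (ball (action_kernel k) r)"
      by (rule inj_on_subset[OF inj_on_nf]) (use sub in \<open>auto simp: ball_def\<close>)
    ultimately have "real (card (ball (action_kernel k) r)) \<le> C * lam ^ r"
      using C(2)[of r] by (simp add: card_image)
    also have "lam ^ r = exp (ln lam * real r)"
      using lam1 by (simp add: exp_of_nat2_mult)
    finally show "real (card (ball (action_kernel k) r)) \<le> C * exp (ln lam * real r)" .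
  qed (use lam1 in simp)
qed

end

context finite_free_basis
begin

text \<open>On a tree (\<open>k = \<infinity>\<close>) one would take \<open>lam = sqrt q\<close> and weights \<open>x ^ j\<close> with \<open>x = 1 / sqrt q\<close> on edges
  leading away from the root. Edges leading back to the root need a large multiple \<open>x ^ i / \<beta>\<close>, where
  \<open>i\<close> is the distance still to go, and the slack \<open>1 + u\<close> in \<open>lam\<close> pays for it. On a cycle the sum
  \<open>a j = x ^ j + x ^ (k - j) / \<beta>\<close> interpolates between the two; for large \<open>k\<close> the second term is
  negligible at \<open>j = 0\<close>.\<close>

lemma poincare_exponent_action_kernel_bound:
  assumes n: "card S \<ge> 2" and u: "0 < u" "u \<le> 1"
  defines "q \<equiv> 2 * real (card S) - 1"
  shows "\<exists>k\<ge>2. poincare_exponent F S (action_kernel k) \<le> ereal (ln (sqrt q * (1 + u)))"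
proof -
  have q: "q \<ge> 3" using n by (simp add: q_def)
  define x where "x = 1 / sqrt q"
  define \<beta> where "\<beta> = u / (2 * q)"
  define lam where "lam = sqrt q * (1 + u)"
  have x: "0 < x" "x < 1" using q by (auto simp: x_def)
  have lx: "lam * x = 1 + u" "lam = q * (1 + u) * x"
    using q by (simp_all add: lam_def x_def real_div_sqrt field_simps)
  have b: "\<beta> > 0" "\<beta> \<le> 1 / 6" "\<beta> \<le> u / 6" "u / \<beta> = 2 * q" "q * \<beta> = u / 2"
    using u q by (auto simp: \<beta>_def field_simps intro: order_trans[OF u(2)])
  \<comment> \<open>The bound \<open>\<beta> ^ 2\<close> makes the returning part of \<open>a 0\<close> at most \<open>\<beta>\<close>.\<close>
  obtain k0 where k0: "\<And>k. k \<ge> k0 \<Longrightarrow> x ^ k < \<beta> ^ 2"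
    using LIMSEQ_realpow_zero[of x] x b order_tendstoD(2)[of "\<lambda>k. x ^ k" 0 sequentially "\<beta> ^ 2"]
    by (auto simp: eventually_sequentially)
  define k where "k = max k0 2"
  define a where "a j = x ^ j + x ^ (k - j) / \<beta>" for j
  define \<phi> where "\<phi> j = \<beta> * (a j + a (k - j))" for j
  have a0: "a 0 \<le> 1 + \<beta>"
    using k0[of k] b(1) by (simp add: a_def k_def power2_eq_square field_simps)
  have a0p: "a 0 \<ge> 0" using x b by (simp add: a_def)
  have sq: "a 0 * (1 + \<beta>) \<le> 1 + u"
  proof -
    have "a 0 * (1 + \<beta>) \<le> (1 + \<beta>) * (1 + \<beta>)" using a0 b by (intro mult_right_mono) auto
    also have "\<dots> = 1 + 2 * \<beta> + \<beta> * \<beta>" by (simp add: algebra_simps)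
    also have "\<beta> * \<beta> \<le> \<beta> * 1" using b by (intro mult_left_mono) auto
    finally show ?thesis using b by simp
  qed
  have k2: "k \<ge> 2" by (simp add: k_def)
  interpret cactus_weights F S k a \<phi> \<beta> lam
  proof
    show "1 < lam"
      unfolding lam_def using q u by (intro less_1_mult) auto
    show "0 < a j" for j using x b by (simp add: a_def add_pos_pos)
    fix j assume j: "0 < j" "j < k"
    \<comment> \<open>The coefficients of \<open>x ^ j\<close> and \<open>x ^ (k - j)\<close> are compared separately.\<close>
    define g where "g = (q - 1) * \<beta> * a 0"
    have g: "g * (1 + 1 / \<beta>) \<le> (q - 1) * (1 + u)"
    proof -
      have "g * (1 + 1 / \<beta>) = (q - 1) * (a 0 * (1 + \<beta>))" using b(1) by (simp add: g_def field_simps)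
      also have "\<dots> \<le> (q - 1) * (1 + u)" using q sq by (intro mult_left_mono) auto
      finally show ?thesis .
    qed
    obtain i where i: "j = Suc i" using j by (cases j) auto
    have kj: "k - (k - j) = j" "k - i = Suc (k - j)" using j i by auto
    have "a j + (2 * real (card S) - 2) * \<phi> j * a 0 = a j + g * (a j + a (k - j))"
      by (simp add: g_def \<phi>_def q_def algebra_simps)
    also have "\<dots> = x ^ j * (1 + g * (1 + 1 / \<beta>)) + x ^ (k - j) * (1 / \<beta> + g * (1 + 1 / \<beta>))"
      using b(1) by (simp add: a_def kj field_simps)
    also have "\<dots> \<le> x ^ j * (q * (1 + u)) + x ^ (k - j) * (1 / \<beta> + u / \<beta>)"
    proof (rule add_mono; rule mult_left_mono)
      show "1 + g * (1 + 1 / \<beta>) \<le> q * (1 + u)" using g u by (simp add: algebra_simps)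
      note g
      also have "(q - 1) * (1 + u) \<le> (q - 1) * 2" using q u by (intro mult_left_mono) auto
      also have "\<dots> \<le> 2 * q" by simp
      finally have "g * (1 + 1 / \<beta>) \<le> 2 * q" .
      then show "1 / \<beta> + g * (1 + 1 / \<beta>) \<le> 1 / \<beta> + u / \<beta>" using b by simp
    qed (use x in auto)
    also have "1 / \<beta> + u / \<beta> = lam * x / \<beta>" by (simp add: lx(1) add_divide_distrib)
    also have "x ^ j * (q * (1 + u)) = lam * x ^ i" by (simp add: i lx(2))
    also have "lam * x ^ i + x ^ (k - j) * (lam * x / \<beta>) = lam * a (j - 1)"
      by (simp add: a_def i kj algebra_simps)
    finally show "a j + (2 * real (card S) - 2) * \<phi> j * a 0 \<le> lam * a (j - 1)" .
  next
    have la: "(1 + u) / \<beta> \<le> lam * a (k - 1)"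
    proof -
      have "(1 + u) / \<beta> = lam * (x / \<beta>)" by (simp add: lx(1)[symmetric])
      also have "\<dots> \<le> lam * a (k - 1)"
        using q u x k2 by (intro mult_left_mono) (auto simp: a_def lam_def)
      finally show ?thesis .
    qed
    have split: "(1 + u) / \<beta> = 1 / \<beta> + 2 * q" using b by (simp add: add_divide_distrib)
    have "(q - 2) * a 0 \<le> q * 2" using q a0 b a0p by (intro mult_mono) auto
    then show "(2 * real (card S) - 3) * a 0 + 1 / \<beta> \<le> lam * a (k - 1)"
      using la split by (simp add: q_def)
    have "q * a 0 \<le> q * 2" using q a0 b a0p by (intro mult_mono) auto
    moreover have "1 / \<beta> \<ge> 0" using b by simp
    ultimately show "(2 * real (card S) - 1) * a 0 \<le> lam * a (k - 1)"
      using la split unfolding q_def by linarith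
  qed (use n b k2 in \<open>auto simp: \<phi>_def\<close>)
  show ?thesis
    using poincare_exponent_action_kernel_le k2 by (auto simp: lam_def)
qed

end

section \<open>Full exponent forces a nontrivial intersection\<close>

definition initial_run :: "'b list \<Rightarrow> nat" where
  "initial_run w = length (takeWhile (\<lambda>l. l = hd w) w)"

definition run_free :: "nat \<Rightarrow> 'b list \<Rightarrow> bool" where
  "run_free K w \<longleftrightarrow> (\<nexists>u l v. w = u @ replicate K l @ v)"

lemma initial_run_Cons: "initial_run (l # w) = (if w \<noteq> [] \<and> hd w = l then Suc (initial_run w) else 1)"
  by (cases w) (auto simp: initial_run_def)

lemma run_free_ConsD: "run_free K (l # w) \<Longrightarrow> run_free K w"
  unfolding run_free_def by (metis append_Cons)

lemma initial_run_less:
  assumes "run_free K w"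
  shows "initial_run w < K"
proof (rule ccontr)
  let ?p = "takeWhile (\<lambda>l. l = hd w) w"
  assume "\<not> initial_run w < K"
  then have le: "K \<le> length ?p" by (simp add: initial_run_def)
  have "?p = replicate (length ?p) (hd w)"
    by (rule replicate_length_same[symmetric]) (auto dest: set_takeWhileD)
  also have "\<dots> = replicate K (hd w) @ replicate (length ?p - K) (hd w)"
    using le by (simp flip: replicate_add)
  finally have "w = [] @ replicate K (hd w) @ (replicate (length ?p - K) (hd w) @ dropWhile (\<lambda>l. l = hd w) w)"
    using takeWhile_dropWhile_id[of "\<lambda>l. l = hd w" w] by (metis append_Nil append_assoc)
  then show False using assms unfolding run_free_def by blast
qed

context finite_free_basis
begin

text \<open>The weight \<open>1 - q ^ j / q ^ K\<close> of a word that starts with a run of length exactly \<open>j\<close> would, with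
  \<open>1\<close> in place of \<open>f 1\<close>, be an eigenfunction of the transfer operator for the eigenvalue \<open>q\<close> that
  vanishes when the run reaches \<open>K\<close>. Since \<open>f 1 < 1\<close>, some slack remains, and the rate drops
  strictly below \<open>q\<close>.\<close>

lemma card_run_free_words_le:
  assumes n: "card S \<ge> 2" and K: "K \<ge> 2"
  shows "\<exists>mu C. 1 < mu \<and> mu < 2 * real (card S) - 1 \<and> 0 < C \<and>
    (\<forall>r. real (card {w \<in> words S. reduced w \<and> run_free K w \<and> length w \<le> r}) \<le> C * mu ^ r)"
proof -
  define q where "q = 2 * real (card S) - 1"
  have q: "q \<ge> 3" using n by (simp add: q_def)
  \<comment> \<open>Here \<open>q * t = 1 - f 1\<close>, so \<open>mu\<close> is \<open>q\<close> minus the total drop of the weights of the \<open>q - 1\<close> new runs below \<open>1\<close>.\<close>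
  define t where "t = 1 / q ^ K"
  define mu where "mu = q - (q - 1) * (q * t)"
  define f where "f j = 1 - q ^ j * t" for j
  define \<Phi> where "\<Phi> w = (if run_free K w then f (initial_run w) else 0)" for w :: "('a \<times> bool) list"
  have t: "t > 0" using q by (simp add: t_def)
  have qt: "q ^ j * t \<le> q ^ i / q ^ K" if "j \<le> i" for i j
    using q that by (simp add: t_def divide_right_mono power_increasing)
  have "q * t \<le> 1 / q"
  proof -
    have "q ^ 2 * t \<le> 1" using qt[OF K] q by simp
    then show ?thesis using q by (simp add: field_simps power2_eq_square)
  qed
  then have "(q - 1) * (q * t) \<le> (q - 1) * (1 / q)" using q by (intro mult_left_mono) auto
  also have "\<dots> < 1" using q by (simp add: field_simps)
  finally have mu: "1 < mu" "mu < q" using q t by (auto simp: mu_def)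
  have f_nonneg: "f j \<ge> 0" if "j \<le> K" for j
    using qt[OF that] q by (simp add: f_def)
  have f_anti: "f (K - 1) \<le> f j" if "j < K" for j
    using that q t by (auto simp: f_def intro!: mult_right_mono power_increasing)
  have f_step: "(q - 1) * f 1 + f (Suc j) \<le> mu * f j" for j
  proof -
    have "mu * (q ^ j * t) \<le> q * (q ^ j * t)" using mu q t by (intro mult_right_mono) auto
    then show ?thesis by (simp add: f_def mu_def algebra_simps)
  qed
  have "\<exists>C>0. \<forall>r. real (card {w \<in> {w \<in> words S. reduced w \<and> run_free K w}. length w \<le> r}) \<le> C * mu ^ r"
  proof (rule card_words_le_of_weight[where \<Phi> = \<Phi> and m = "f (K - 1)"])
    fix w assume w: "w \<in> words S" "reduced w" "w \<noteq> []"
    show "(\<Sum>l\<in>next_letters w. \<Phi> (l # w)) \<le> mu * \<Phi> w"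
    proof (cases "run_free K w")
      case False
      then show ?thesis by (auto simp: \<Phi>_def dest: run_free_ConsD intro!: sum_nonpos)
    next
      case True
      let ?j = "initial_run w"
      have j: "?j < K" by (rule initial_run_less[OF True])
      have mem: "hd w \<in> next_letters w"
        using w by (cases w) (auto simp: next_letters_eq)
      have "(\<Sum>l\<in>next_letters w - {hd w}. \<Phi> (l # w)) \<le> (\<Sum>l\<in>next_letters w - {hd w}. f 1)"
        using f_nonneg[of 1] K by (intro sum_mono) (auto simp: \<Phi>_def initial_run_Cons)
      moreover have "real (card (next_letters w - {hd w})) = q - 1"
        using mem card_next_letters[OF w] n by (simp add: q_def of_nat_diff)
      moreover have "\<Phi> (hd w # w) \<le> f (Suc ?j)"
        using f_nonneg[of "Suc ?j"] j w(3) by (auto simp: \<Phi>_def initial_run_Cons)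
      moreover have "(\<Sum>l\<in>next_letters w. \<Phi> (l # w)) = \<Phi> (hd w # w) + (\<Sum>l\<in>next_letters w - {hd w}. \<Phi> (l # w))"
        using mem by (intro sum.remove) auto
      ultimately show ?thesis using f_step[of ?j] True by (simp add: \<Phi>_def)
    qed
  next
    show "\<Phi> w \<ge> 0" for w
      using f_nonneg initial_run_less[of K w] by (auto simp: \<Phi>_def)
    show "f (K - 1) \<le> \<Phi> w" if "w \<in> {w \<in> words S. reduced w \<and> run_free K w}" for w
      using that f_anti initial_run_less[of K w] by (auto simp: \<Phi>_def)
    have "q ^ (K - 1) * t = 1 / q" using K q by (simp add: t_def power_diff)
    then show "f (K - 1) > 0" using q by (simp add: f_def)
  qed (use mu in auto)
  then show ?thesis using mu by (auto simp: q_def conj_assoc)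
qed

text \<open>Deleting a \<open>K\<close>-th power of a letter from a word stays in the same coset of \<open>M\<close> and shortens it.\<close>

lemma run_free_coset_representative:
  assumes M: "M \<lhd> F" and powers: "\<And>l. l \<in> letters \<Longrightarrow> val (replicate K l) \<in> M" and K: "K \<ge> 1"
    and "x \<in> carrier F"
  shows "\<exists>w. w \<in> words S \<and> reduced w \<and> run_free K w \<and> length w \<le> length (nf x) \<and> inv x \<otimes> val w \<in> M"
  using assms(4)
proof (induction "length (nf x)" arbitrary: x rule: less_induct)
  case less
  have sub: "subgroup M F" using M by (rule normal_imp_subgroup)
  note nfx = nf_props[OF less.prems]
  show ?case
  proof (cases "run_free K (nf x)")
    case True
    then show ?thesis
      using nfx less.prems subgroup.one_closed[OF sub] by (intro exI[of _ "nf x"]) simp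
  next
    case False
    then obtain u l v where eq: "nf x = u @ replicate K l @ v" by (auto simp: run_free_def)
    have "l \<in> set (nf x)" using K by (simp add: eq)
    then have l: "l \<in> letters" using nfx(1) by (auto simp: words_def)
    have w: "u \<in> words S" "v \<in> words S" "replicate K l \<in> words S" using nfx(1) by (auto simp: eq)
    let ?p = "val (replicate K l)"
    let ?x' = "val (u @ v)"
    have x: "x = val u \<otimes> (?p \<otimes> val v)"
      using nfx(3) w by (simp add: eq val_append)
    have shorter: "length (nf ?x') < length (nf x)"
      using length_nf_val_le[of "u @ v"] w K by (simp add: eq)
    have x': "?x' \<in> carrier F" using w by simp
    have p: "?p \<in> carrier F" "inv ?p \<in> M"
      using w powers[OF l] subgroup.m_inv_closed[OF sub] by auto
    have "inv x \<otimes> ?x' = inv (val v) \<otimes> inv ?p \<otimes> inv (inv (val v))"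
      using w p unfolding x by (simp add: val_append inv_mult_group m_assoc) (simp add: m_assoc[symmetric])
    also have "\<dots> \<in> M"
      using normal.inv_op_closed2[OF M, of "inv (val v)"] p w by simp
    finally have xx': "inv x \<otimes> ?x' \<in> M" .
    obtain w' where w': "w' \<in> words S" "reduced w'" "run_free K w'" "length w' \<le> length (nf ?x')"
        "inv ?x' \<otimes> val w' \<in> M"
      using less.hyps[OF shorter x'] by blast
    have "inv x \<otimes> val w' = (inv x \<otimes> ?x') \<otimes> (inv ?x' \<otimes> val w')"
      using less.prems x' w'(1) by (simp add: m_assoc) (simp add: m_assoc[symmetric])
    then have "inv x \<otimes> val w' \<in> M" using subgroup.m_closed[OF sub xx' w'(5)] by simp
    then show ?thesis using w' shorter by (intro exI[of _ w']) auto
  qed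
qed

text \<open>Distinct elements of \<open>G\<close> lie in distinct cosets of \<open>M\<close>, hence have distinct representatives.\<close>

lemma poincare_exponent_less_of_trivial_intersection:
  assumes n: "card S \<ge> 2" and G: "subgroup G F" and M: "M \<lhd> F" and trivial: "G \<inter> M = {\<one>}"
    and powers: "\<And>l. l \<in> letters \<Longrightarrow> val (replicate K l) \<in> M" and K: "K \<ge> 2"
  shows "poincare_exponent F S G < ereal (ln (2 * real (card S) - 1))"
proof -
  have GF: "G \<subseteq> carrier F" using G by (rule subgroup.subset)
  have sub: "subgroup M F" using M by (rule normal_imp_subgroup)
  let ?W = "\<lambda>r. {w \<in> words S. reduced w \<and> run_free K w \<and> length w \<le> r}"
  obtain mu C where mu: "1 < mu" "mu < 2 * real (card S) - 1" and C: "0 < C"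
    "\<And>r. real (card (?W r)) \<le> C * mu ^ r"
    using card_run_free_words_le[OF n K] by blast
  have "\<forall>g\<in>G. \<exists>w. w \<in> words S \<and> reduced w \<and> run_free K w \<and> length w \<le> length (nf g) \<and> inv g \<otimes> val w \<in> M"
    using run_free_coset_representative[OF M powers] K GF by auto
  then obtain f where f: "\<And>g. g \<in> G \<Longrightarrow> f g \<in> words S \<and> reduced (f g) \<and> run_free K (f g) \<and>
      length (f g) \<le> length (nf g) \<and> inv g \<otimes> val (f g) \<in> M"
    by (auto dest!: bchoice)
  have inj: "inj_on f G"
  proof (rule inj_onI)
    fix g g' assume g: "g \<in> G" "g' \<in> G" "f g = f g'"
    have F: "g \<in> carrier F" "g' \<in> carrier F" "val (f g) \<in> carrier F" using g GF f by auto
    have "(inv g \<otimes> val (f g)) \<otimes> inv (inv g' \<otimes> val (f g)) \<in> M"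
      using f[OF g(1)] f[OF g(2)] g(3) sub by (simp add: subgroup.m_closed subgroup.m_inv_closed)
    also have "(inv g \<otimes> val (f g)) \<otimes> inv (inv g' \<otimes> val (f g)) = inv g \<otimes> g'"
      using F by (simp add: inv_mult_group m_assoc) (simp add: m_assoc[symmetric])
    finally have "inv g \<otimes> g' \<in> G \<inter> M"
      using g G by (simp add: subgroup.m_closed subgroup.m_inv_closed)
    then have "inv g \<otimes> g' = \<one>" using trivial by auto
    then show "g = g'" using F by (metis inv_equality inv_inv inv_closed)
  qed
  have "poincare_exponent F S G \<le> ereal (ln mu)"
  proof (rule poincare_exponent_le[OF GF _ C(1), of _ 0])
    fix r :: nat
    have "card (ball G r) \<le> card (?W r)"
    proof (rule card_inj_on_le[where f = f])
      show "inj_on f (ball G r)" by (rule inj_on_subset[OF inj]) (auto simp: ball_def)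
      show "f ` ball G r \<subseteq> ?W r" using f by (force simp: ball_def)
      show "finite (?W r)" by (rule finite_subset[OF _ finite_words_le[of r]]) auto
    qed
    also have "real (card (?W r)) \<le> C * mu ^ r" by (rule C(2))
    also have "mu ^ r = exp (ln mu * real r)" using mu by (simp add: exp_of_nat2_mult)
    finally show "real (card (ball G r)) \<le> C * exp (ln mu * real r)" by simp
  qed (use mu in simp)
  also have "\<dots> < ereal (ln (2 * real (card S) - 1))" using mu by simp
  finally show ?thesis .
qed

lemma poincare_exponent_mono:
  assumes "H \<subseteq> K" "K \<subseteq> carrier F"
  shows "poincare_exponent F S H \<le> poincare_exponent F S K"
  unfolding poincare_exponent_def
proof (rule Limsup_mono, rule eventually_mono[OF eventually_gt_at_top[of 0]])
  fix R :: real assume R: "R > 0"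
  let ?h = "card (ball H (nat \<lfloor>R\<rfloor>))" and ?k = "card (ball K (nat \<lfloor>R\<rfloor>))"
  have "?h \<le> ?k"
    by (rule card_mono[OF finite_ball[OF assms(2)]]) (use assms in \<open>auto simp: ball_def\<close>)
  then have "ln (real ?h) \<le> ln (real ?k)"
    by (cases "?h = 0"; cases "?k = 0") auto
  then show "ereal (1 / R * ln (real (card {g \<in> H. real (word_metric F S \<one> g) \<le> R})))
      \<le> ereal (1 / R * ln (real (card {g \<in> K. real (word_metric F S \<one> g) \<le> R})))"
    using R assms by (simp add: ball_subset_metric divide_right_mono)
qed

theorem normal_subgroups_exponent_tendsto_half:
  assumes n: "card S \<ge> 2" and G: "subgroup G F"
    and full: "poincare_exponent F S G = poincare_exponent F S (carrier F)"
  shows "\<exists>N :: nat \<Rightarrow> 'a set. (\<forall>k. N k \<lhd> F\<lparr>carrier := G\<rparr>) \<and>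
    (\<lambda>k. poincare_exponent F S (N k)) \<longlonglongrightarrow> ereal (1 / 2) * poincare_exponent F S G"
proof -
  let ?q = "2 * real (card S) - 1"
  have q: "?q \<ge> 3" using n by simp
  define u :: "nat \<Rightarrow> real" where "u i = 1 / (real i + 1)" for i
  have "\<forall>i. \<exists>k\<ge>2. poincare_exponent F S (action_kernel k) \<le> ereal (ln (sqrt ?q * (1 + u i)))"
    using poincare_exponent_action_kernel_bound[OF n] by (simp add: u_def)
  then obtain K where K: "\<And>i. K i \<ge> 2"
    "\<And>i. poincare_exponent F S (action_kernel (K i)) \<le> ereal (ln (sqrt ?q * (1 + u i)))"
    by metis
  define N where "N i = action_kernel (K i) \<inter> G" for i
  have K0: "0 < K i" for i using K(1)[of i] by simp
  have normal: "N i \<lhd> F\<lparr>carrier := G\<rparr>" for i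
    unfolding N_def using normal_Int_subgroup[OF G normal_action_kernel[OF K0]] .
  have q_le: "ereal (ln ?q) \<le> poincare_exponent F S G"
    using poincare_exponent_carrier_ge[OF n] n by (simp add: full of_nat_diff)
  have lower: "ereal (1 / 2) * poincare_exponent F S G \<le> poincare_exponent F S (N i)" for i
  proof (rule half_poincare_exponent_le_normal[OF G normal])
    show "N i \<noteq> {\<one>}"
    proof
      assume "N i = {\<one>}"
      then have "G \<inter> action_kernel (K i) = {\<one>}" by (auto simp: N_def)
      then have "poincare_exponent F S G < ereal (ln ?q)"
        using poincare_exponent_less_of_trivial_intersection[OF n G normal_action_kernel[OF K0] _ val_power_in_action_kernel[OF _ K0] K(1)]
        by blast
      with q_le show False by simp
    qed
  qed
  have upper: "poincare_exponent F S (N i) \<le> ereal (ln (sqrt ?q * (1 + u i)))" for i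
    using poincare_exponent_mono[of "N i" "action_kernel (K i)"] K(2)[of i]
    by (auto simp: N_def action_kernel_def intro: order_trans)
  have "(\<lambda>i. u i) \<longlonglongrightarrow> 0"
    unfolding u_def using LIMSEQ_inverse_real_of_nat by (simp add: inverse_eq_divide add.commute)
  then have "(\<lambda>i. ln (sqrt ?q * (1 + u i))) \<longlonglongrightarrow> ln (sqrt ?q * (1 + 0))"
    using q by (intro tendsto_intros) auto
  then have lim: "(\<lambda>i. ereal (ln (sqrt ?q * (1 + u i)))) \<longlonglongrightarrow> ereal (1 / 2 * ln ?q)"
    using q by (simp add: ln_sqrt)
  \<comment> \<open>Half the exponent of \<open>G\<close> lies below all exponents of the \<open>N i\<close>, so the upper bounds on these pin it down.\<close>
  have "ereal (1 / 2) * poincare_exponent F S G \<le> ereal (1 / 2 * ln ?q)"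
    by (rule LIMSEQ_le_const[OF lim]) (use lower upper in \<open>blast intro: order_trans\<close>)
  moreover have "ereal (1 / 2 * ln ?q) \<le> ereal (1 / 2) * poincare_exponent F S G"
    using ereal_mult_left_mono[OF q_le, of "ereal (1 / 2)"] by simp
  ultimately have half: "ereal (1 / 2) * poincare_exponent F S G = ereal (1 / 2 * ln ?q)" by simp
  have "(\<lambda>i. poincare_exponent F S (N i)) \<longlonglongrightarrow> ereal (1 / 2) * poincare_exponent F S G"
  proof (rule tendsto_sandwich[OF _ _ tendsto_const])
    show "(\<lambda>i. ereal (ln (sqrt ?q * (1 + u i)))) \<longlonglongrightarrow> ereal (1 / 2) * poincare_exponent F S G"
      using lim by (simp only: half)
  qed (use lower upper in auto)
  with normal show ?thesis by blast
qed

end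

theorem corollary1p5:
  fixes F :: "('a, 'm) monoid_scheme" and S :: "'a set" and n :: nat
    and I :: "'i set" and g :: "'i \<Rightarrow> 'a" and G :: "'a set"
  assumes "group F"
    and "free_generating_set F S"
    and "card S = n"
    and "n \<ge> 2"
    and "\<And>i. i \<in> I \<Longrightarrow> g i \<in> carrier F"
    and "G = generate F (g ` I)"
    and "poincare_exponent F S G = poincare_exponent F S (carrier F)"
  shows "\<exists>N :: nat \<Rightarrow> 'a set.
    (\<forall>k. N k \<lhd> F\<lparr>carrier := G\<rparr>) \<and>
    (\<lambda>k. poincare_exponent F S (N k)) \<longlonglongrightarrow> ereal (1 / 2) * poincare_exponent F S G"
proof -
  have "finite S" using assms(3,4) card.infinite by force
  then interpret finite_free_basis F S
    using assms(1,2) by (simp add: finite_free_basis_def finite_free_basis_axioms_def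
      free_basis_def free_basis_axioms_def)
  have "subgroup G F"
    unfolding assms(6) by (rule generate_is_subgroup) (use assms(5) in auto)
  then show ?thesis
    using normal_subgroups_exponent_tendsto_half assms(3,4,7) by simp
qed

end
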